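(* Let $G$ be a finite group, $H$ an abelian subgroup of $G$, and let $\Omega\in\mathbb{C}(H)\otimes\mathbb{C}(H)\subset\mathbb{C}(G)\otimes\mathbb{C}(G)$ be a (pseudo)-co-involutive 2-(pseudo)-cocycle of $\mathbb{C}(G)$ lifted from $H$, such that $(\mathbb{C}(G),\Delta_\Omega,\varepsilon,\kappa_\Omega)$ is a Kac algebra (the twisted Kac algebra). Let $\alpha$ be an automorphism of $G$, extended to $\mathbb{C}(G)$ by $\alpha(\lambda(g))=\lambda(\alpha(g))$. If $\alpha\otimes\alpha$ commutes with $\mathrm{Ad}\,\Omega$, then $\alpha$ is an automorphism of the twisted Kac algebra $(\mathbb{C}(G),\Delta_\Omega,\varepsilon,\kappa_\Omega)$. In particular, it is sufficient that $\alpha|_H=\mathrm{id}$.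
   Context: $\mathbb{C}(G)$ is the $C^*$-algebra generated by the left regular representation $\lambda$ of $G$, a cocommutative Kac algebra with $\Delta(\lambda(g))=\lambda(g)\otimes\lambda(g)$, $\varepsilon(\lambda(g))=1$, $\kappa(\lambda(g))=\lambda(g^{-1})$; $\mathbb{C}(H)\subset\mathbb{C}(G)$ is the subalgebra generated by $\lambda(h)$, $h\in H$. A (finite dimensional) Kac algebra is a finite dimensional $C^*$-algebra with a coassociative unital $*$-homomorphism as coproduct, a counit, and an antipode which is an involutive $*$-anti-automorphism. An automorphism of a Kac algebra is a $*$-algebra automorphism which intertwines the coproduct and preserves the counit and antipode. $\mathrm{Ad}\,\Omega(x)=\Omega x\Omega^*$ for $x\in\mathbb{C}(G)\otimes\mathbb{C}(G)$. Twisting. With $A=\mathbb{C}(G)$, a 2-cocycle is a unitary $\Omega\in A\otimes A$ with $(\Omega\otimes1)(\Delta\otimes \mathrm{id})(\Omega)=(1\otimes\Omega)(\mathrm{id}\otimes\Delta)(\Omega)$; a 2-pseudo-cocycle is a unitary $\Omega$ such that $(\mathrm{id}\otimes\Delta)(\Omega^* )(1\otimes\Omega^* )(\Omega\otimes1)(\Delta\otimes \mathrm{id})(\Omega)$ lies in the commutant of $(\Delta\otimes \mathrm{id})\Delta(A)$. Put $\Delta_\Omega(x)=\Omega\Delta(x)\Omega^*$ (coassociative iff $\Omega$ is a 2-pseudo-cocycle). For a unitary $u\in A$ put $\Omega^u=(u^*\otimes u^* )\Omega\Delta(u)$, and let $\Sigma$ be the flip of $A\otimes A$. $\Omega$ is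 pseudo-co-involutive (resp. co-involutive), with respect to $u$, if $\Omega^u(\Sigma(\kappa\otimes\kappa)(\Omega^* ))^*\in\Delta(A)'$ (resp. $\Sigma(\kappa\otimes\kappa)(\Omega^* )=\Omega^u$). In that case $\kappa_\Omega(x)=u\kappa(x)u^*$. Lifting from $H$. Let $\hat H$ be the dual group of $H$ and let $P_x$, $x\in\hat H$, be the mutually orthogonal projections in $\mathbb{C}(H)$ determined by $\lambda(h)=\sum_{x\in\hat H}\langle x,h\rangle P_x$. The lifted element is $\Omega=\sum_{x,y\in\hat H}\omega(x,y)\,P_x\otimes P_y$ for a function $\omega:\hat H\times\hat H\to\mathbb{T}$, and $u=m(\mathrm{id}\otimes\kappa)\Omega=\sum_{x\in\hat H}\omega(x,x^{-1})P_x$, where $m$ is the multiplication of $A$. *)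

theory Defs
  imports Complex_Main "HOL-Algebra.Group" "HOL-Library.FuncSet" "HOL-Library.Function_Algebras"
begin

section \<open>Matrices over a finite index set\<close>

text \<open>
  Operators on \<open>\<ell>\<^sup>2(I)\<close>, for a finite set \<open>I\<close>, are matrices whose entries vanish off \<open>I \<times> I\<close>.
  Addition, zero and finite sums are those of \<open>HOL-Library.Function_Algebras\<close>, hence entrywise;
  the entrywise product of that theory is never used.
\<close>

type_synonym 'i mtx = "'i \<Rightarrow> 'i \<Rightarrow> complex"

definition mats :: "'i set \<Rightarrow> 'i mtx set" where
  "mats I = {X. \<forall>i j. X i j \<noteq> 0 \<longrightarrow> i \<in> I \<and> j \<in> I}"

definition mmult :: "'i set \<Rightarrow> 'i mtx \<Rightarrow> 'i mtx \<Rightarrow> 'i mtx" where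
  "mmult I X Y = (\<lambda>i j. \<Sum>k\<in>I. X i k * Y k j)"

abbreviation mmult_syntax :: "'i mtx \<Rightarrow> 'i set \<Rightarrow> 'i mtx \<Rightarrow> 'i mtx"
    (\<open>_ \<odot>\<^bsub>_\<^esub> _\<close> [70, 0, 71] 70) where
  "X \<odot>\<^bsub>I\<^esub> Y \<equiv> mmult I X Y"

definition mone :: "'i set \<Rightarrow> 'i mtx" where
  "mone I = (\<lambda>i j. if i \<in> I \<and> i = j then 1 else 0)"

definition msmult :: "complex \<Rightarrow> 'i mtx \<Rightarrow> 'i mtx" (infixr \<open>\<cdot>\<close> 75) where
  "c \<cdot> X = (\<lambda>i j. c * X i j)"

definition madj :: "'i mtx \<Rightarrow> 'i mtx" where
  "madj X = (\<lambda>i j. cnj (X j i))"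

definition kron :: "'i mtx \<Rightarrow> 'j mtx \<Rightarrow> ('i \<times> 'j) mtx" where
  "kron X Y = (\<lambda>p q. X (fst p) (fst q) * Y (snd p) (snd q))"

text \<open>Identification of operators on \<open>(U \<otimes> V) \<otimes> W\<close> with operators on \<open>U \<otimes> (V \<otimes> W)\<close>.\<close>

definition massoc :: "(('i \<times> 'j) \<times> 'k) mtx \<Rightarrow> ('i \<times> 'j \<times> 'k) mtx" where
  "massoc X = (\<lambda>(i, j, k) (i', j', k'). X ((i, j), k) ((i', j'), k'))"

definition commutant :: "'i set \<Rightarrow> 'i mtx set \<Rightarrow> 'i mtx set" where
  "commutant I S = {T \<in> mats I. \<forall>X\<in>S. T \<odot>\<^bsub>I\<^esub> X = X \<odot>\<^bsub>I\<^esub> T}"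

section \<open>Finite dimensional C*-algebras\<close>

text \<open>
  A finite dimensional C*-algebra is represented as a unital *-subalgebra of a full matrix algebra.
  Such a subalgebra is automatically closed in norm, so the C*-algebra generated by a set is the
  smallest one containing that set.
\<close>

definition star_subalgebra :: "'i set \<Rightarrow> 'i mtx set \<Rightarrow> bool" where
  "star_subalgebra I A \<longleftrightarrow> finite I \<and> A \<subseteq> mats I \<and> mone I \<in> A \<and>
     (\<forall>X\<in>A. \<forall>Y\<in>A. X + Y \<in> A \<and> X \<odot>\<^bsub>I\<^esub> Y \<in> A) \<and>
     (\<forall>X\<in>A. madj X \<in> A \<and> (\<forall>c. c \<cdot> X \<in> A))"

definition cstar_generated :: "'i set \<Rightarrow> 'i mtx set \<Rightarrow> 'i mtx set" where
  "cstar_generated I S = star_subalgebra I hull S"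

definition linear_map :: "'i mtx set \<Rightarrow> ('i mtx \<Rightarrow> 'j mtx) \<Rightarrow> bool" where
  "linear_map A f \<longleftrightarrow>
     (\<forall>X\<in>A. \<forall>Y\<in>A. f (X + Y) = f X + f Y) \<and> (\<forall>c. \<forall>X\<in>A. f (c \<cdot> X) = c \<cdot> f X)"

definition star_hom ::
  "'i set \<Rightarrow> 'i mtx set \<Rightarrow> 'j set \<Rightarrow> 'j mtx set \<Rightarrow> ('i mtx \<Rightarrow> 'j mtx) \<Rightarrow> bool" where
  "star_hom I A J B f \<longleftrightarrow> f \<in> A \<rightarrow> B \<and> linear_map A f \<and> f (mone I) = mone J \<and>
     (\<forall>X\<in>A. \<forall>Y\<in>A. f (X \<odot>\<^bsub>I\<^esub> Y) = f X \<odot>\<^bsub>J\<^esub> f Y) \<and>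
     (\<forall>X\<in>A. f (madj X) = madj (f X))"

definition unitary_in :: "'i set \<Rightarrow> 'i mtx set \<Rightarrow> 'i mtx \<Rightarrow> bool" where
  "unitary_in I A U \<longleftrightarrow>
     U \<in> A \<and> madj U \<odot>\<^bsub>I\<^esub> U = mone I \<and> U \<odot>\<^bsub>I\<^esub> madj U = mone I"

section \<open>Tensor products of algebras and of maps\<close>

definition tensor :: "'i mtx set \<Rightarrow> 'j mtx set \<Rightarrow> ('i \<times> 'j) mtx set" where
  "tensor A B = {X. \<exists>(n::nat) a b. (\<forall>k<n. a k \<in> A \<and> b k \<in> B) \<and> X = (\<Sum>k<n. kron (a k) (b k))}"

text \<open>
  The linear map on \<open>A \<otimes> B\<close> induced by a bilinear map \<open>\<phi>\<close> on \<open>A \<times> B\<close>: the value at \<open>X\<close> is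
  \<open>\<Sum>k. \<phi> (a k) (b k)\<close> for any way of writing \<open>X = \<Sum>k. a k \<otimes> b k\<close>; bilinearity of \<open>\<phi>\<close> makes this
  independent of the choice. The maps \<open>f \<otimes> g\<close>, \<open>\<epsilon> \<otimes> id\<close>, \<open>m(id \<otimes> \<kappa>)\<close> and the flip are instances.
\<close>

definition tensor_lift ::
  "'i mtx set \<Rightarrow> 'j mtx set \<Rightarrow> ('i mtx \<Rightarrow> 'j mtx \<Rightarrow> 'k mtx) \<Rightarrow> ('i \<times> 'j) mtx \<Rightarrow> 'k mtx" where
  "tensor_lift A B \<phi> X = (THE Y. \<exists>(n::nat) a b. (\<forall>k<n. a k \<in> A \<and> b k \<in> B) \<and>
     X = (\<Sum>k<n. kron (a k) (b k)) \<and> Y = (\<Sum>k<n. \<phi> (a k) (b k)))"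

definition tensor_map ::
  "'i mtx set \<Rightarrow> 'j mtx set \<Rightarrow> ('i mtx \<Rightarrow> 'k mtx) \<Rightarrow> ('j mtx \<Rightarrow> 'l mtx) \<Rightarrow>
     ('i \<times> 'j) mtx \<Rightarrow> ('k \<times> 'l) mtx" where
  "tensor_map A B f g = tensor_lift A B (\<lambda>a b. kron (f a) (g b))"

definition flip :: "'i mtx set \<Rightarrow> ('i \<times> 'i) mtx \<Rightarrow> ('i \<times> 'i) mtx" where
  "flip A = tensor_lift A A (\<lambda>a b. kron b a)"

section \<open>Finite dimensional Kac algebras\<close>

definition coassociative :: "'i mtx set \<Rightarrow> ('i mtx \<Rightarrow> ('i \<times> 'i) mtx) \<Rightarrow> bool" where
  "coassociative A \<Delta> \<longleftrightarrow>
     (\<forall>X\<in>A. massoc (tensor_map A A \<Delta> (\<lambda>x. x) (\<Delta> X)) = tensor_map A A (\<lambda>x. x) \<Delta> (\<Delta> X))"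

definition is_counit ::
  "'i set \<Rightarrow> 'i mtx set \<Rightarrow> ('i mtx \<Rightarrow> ('i \<times> 'i) mtx) \<Rightarrow> ('i mtx \<Rightarrow> complex) \<Rightarrow> bool" where
  "is_counit I A \<Delta> \<epsilon> \<longleftrightarrow> \<epsilon> (mone I) = 1 \<and>
     (\<forall>X\<in>A. \<forall>Y\<in>A. \<epsilon> (X + Y) = \<epsilon> X + \<epsilon> Y \<and> \<epsilon> (X \<odot>\<^bsub>I\<^esub> Y) = \<epsilon> X * \<epsilon> Y) \<and>
     (\<forall>X\<in>A. \<epsilon> (madj X) = cnj (\<epsilon> X) \<and> (\<forall>c. \<epsilon> (c \<cdot> X) = c * \<epsilon> X)) \<and>
     (\<forall>X\<in>A. tensor_lift A A (\<lambda>a b. \<epsilon> a \<cdot> b) (\<Delta> X) = X \<and>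
            tensor_lift A A (\<lambda>a b. \<epsilon> b \<cdot> a) (\<Delta> X) = X)"

definition is_antipode ::
  "'i set \<Rightarrow> 'i mtx set \<Rightarrow> ('i mtx \<Rightarrow> ('i \<times> 'i) mtx) \<Rightarrow> ('i mtx \<Rightarrow> complex) \<Rightarrow>
     ('i mtx \<Rightarrow> 'i mtx) \<Rightarrow> bool" where
  "is_antipode I A \<Delta> \<epsilon> \<kappa> \<longleftrightarrow> \<kappa> \<in> A \<rightarrow> A \<and> linear_map A \<kappa> \<and>
     (\<forall>X\<in>A. \<kappa> (\<kappa> X) = X \<and> \<kappa> (madj X) = madj (\<kappa> X)) \<and>
     (\<forall>X\<in>A. \<forall>Y\<in>A. \<kappa> (X \<odot>\<^bsub>I\<^esub> Y) = \<kappa> Y \<odot>\<^bsub>I\<^esub> \<kappa> X) \<and>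
     (\<forall>X\<in>A. tensor_lift A A (\<lambda>a b. \<kappa> a \<odot>\<^bsub>I\<^esub> b) (\<Delta> X) = \<epsilon> X \<cdot> mone I \<and>
            tensor_lift A A (\<lambda>a b. a \<odot>\<^bsub>I\<^esub> \<kappa> b) (\<Delta> X) = \<epsilon> X \<cdot> mone I)"

definition kac_algebra ::
  "'i set \<Rightarrow> 'i mtx set \<Rightarrow> ('i mtx \<Rightarrow> ('i \<times> 'i) mtx) \<Rightarrow> ('i mtx \<Rightarrow> complex) \<Rightarrow>
     ('i mtx \<Rightarrow> 'i mtx) \<Rightarrow> bool" where
  "kac_algebra I A \<Delta> \<epsilon> \<kappa> \<longleftrightarrow> star_subalgebra I A \<and>
     star_hom I A (I \<times> I) (tensor A A) \<Delta> \<and> coassociative A \<Delta> \<and>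
     is_counit I A \<Delta> \<epsilon> \<and> is_antipode I A \<Delta> \<epsilon> \<kappa>"

definition kac_automorphism ::
  "'i set \<Rightarrow> 'i mtx set \<Rightarrow> ('i mtx \<Rightarrow> ('i \<times> 'i) mtx) \<Rightarrow> ('i mtx \<Rightarrow> complex) \<Rightarrow>
     ('i mtx \<Rightarrow> 'i mtx) \<Rightarrow> ('i mtx \<Rightarrow> 'i mtx) \<Rightarrow> bool" where
  "kac_automorphism I A \<Delta> \<epsilon> \<kappa> f \<longleftrightarrow> star_hom I A I A f \<and> bij_betw f A A \<and>
     (\<forall>X\<in>A. tensor_map A A f f (\<Delta> X) = \<Delta> (f X)) \<and>
     (\<forall>X\<in>A. \<epsilon> (f X) = \<epsilon> X) \<and> (\<forall>X\<in>A. f (\<kappa> X) = \<kappa> (f X))"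

section \<open>The Kac algebra of a finite group\<close>

definition lreg :: "('g, 'm) monoid_scheme \<Rightarrow> 'g \<Rightarrow> 'g mtx" where
  "lreg G g = (\<lambda>i j. if j \<in> carrier G \<and> i = g \<otimes>\<^bsub>G\<^esub> j then 1 else 0)"

definition group_cstar :: "('g, 'm) monoid_scheme \<Rightarrow> 'g set \<Rightarrow> 'g mtx set" where
  "group_cstar G H = cstar_generated (carrier G) (lreg G ` H)"

abbreviation group_alg :: "('g, 'm) monoid_scheme \<Rightarrow> 'g mtx set" where
  "group_alg G \<equiv> group_cstar G (carrier G)"

text \<open>
  Every \<open>X\<close> in the algebra is \<open>\<Sum>g. X g 1 \<cdot> \<lambda>(g)\<close> (lemma \<open>group_alg_expansion\<close> below), so the
  maps below are the linear extensions of their values on the \<open>\<lambda>(g)\<close>.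
\<close>

definition coprod :: "('g, 'm) monoid_scheme \<Rightarrow> 'g mtx \<Rightarrow> ('g \<times> 'g) mtx" where
  "coprod G X = (\<Sum>g\<in>carrier G. X g \<one>\<^bsub>G\<^esub> \<cdot> kron (lreg G g) (lreg G g))"

definition counit :: "('g, 'm) monoid_scheme \<Rightarrow> 'g mtx \<Rightarrow> complex" where
  "counit G X = (\<Sum>g\<in>carrier G. X g \<one>\<^bsub>G\<^esub>)"

definition antipode :: "('g, 'm) monoid_scheme \<Rightarrow> 'g mtx \<Rightarrow> 'g mtx" where
  "antipode G X = (\<Sum>g\<in>carrier G. X g \<one>\<^bsub>G\<^esub> \<cdot> lreg G (inv\<^bsub>G\<^esub> g))"

definition extend_aut :: "('g, 'm) monoid_scheme \<Rightarrow> ('g \<Rightarrow> 'g) \<Rightarrow> 'g mtx \<Rightarrow> 'g mtx" where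
  "extend_aut G \<alpha> X = (\<Sum>g\<in>carrier G. X g \<one>\<^bsub>G\<^esub> \<cdot> lreg G (\<alpha> g))"

section \<open>Twisting\<close>

definition coprod_l :: "('g, 'm) monoid_scheme \<Rightarrow> ('g \<times> 'g) mtx \<Rightarrow> ('g \<times> 'g \<times> 'g) mtx" where
  "coprod_l G X = massoc (tensor_map (group_alg G) (group_alg G) (coprod G) (\<lambda>x. x) X)"

definition coprod_r :: "('g, 'm) monoid_scheme \<Rightarrow> ('g \<times> 'g) mtx \<Rightarrow> ('g \<times> 'g \<times> 'g) mtx" where
  "coprod_r G X = tensor_map (group_alg G) (group_alg G) (\<lambda>x. x) (coprod G) X"

definition amp_l :: "('g, 'm) monoid_scheme \<Rightarrow> ('g \<times> 'g) mtx \<Rightarrow> ('g \<times> 'g \<times> 'g) mtx" where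
  "amp_l G X = massoc (kron X (mone (carrier G)))"

definition amp_r :: "('g, 'm) monoid_scheme \<Rightarrow> ('g \<times> 'g) mtx \<Rightarrow> ('g \<times> 'g \<times> 'g) mtx" where
  "amp_r G X = kron (mone (carrier G)) X"

abbreviation carrier2 :: "('g, 'm) monoid_scheme \<Rightarrow> ('g \<times> 'g) set" where
  "carrier2 G \<equiv> carrier G \<times> carrier G"

abbreviation carrier3 :: "('g, 'm) monoid_scheme \<Rightarrow> ('g \<times> 'g \<times> 'g) set" where
  "carrier3 G \<equiv> carrier G \<times> carrier G \<times> carrier G"

definition two_cocycle :: "('g, 'm) monoid_scheme \<Rightarrow> ('g \<times> 'g) mtx \<Rightarrow> bool" where
  "two_cocycle G \<Omega> \<longleftrightarrow>
     unitary_in (carrier2 G) (tensor (group_alg G) (group_alg G)) \<Omega> \<and>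
     amp_l G \<Omega> \<odot>\<^bsub>carrier3 G\<^esub> coprod_l G \<Omega> = amp_r G \<Omega> \<odot>\<^bsub>carrier3 G\<^esub> coprod_r G \<Omega>"

definition two_pseudo_cocycle :: "('g, 'm) monoid_scheme \<Rightarrow> ('g \<times> 'g) mtx \<Rightarrow> bool" where
  "two_pseudo_cocycle G \<Omega> \<longleftrightarrow>
     unitary_in (carrier2 G) (tensor (group_alg G) (group_alg G)) \<Omega> \<and>
     coprod_r G (madj \<Omega>) \<odot>\<^bsub>carrier3 G\<^esub> amp_r G (madj \<Omega>) \<odot>\<^bsub>carrier3 G\<^esub> amp_l G \<Omega>
         \<odot>\<^bsub>carrier3 G\<^esub> coprod_l G \<Omega>
       \<in> commutant (carrier3 G) ((\<lambda>X. coprod_l G (coprod G X)) ` group_alg G)"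

definition Ad :: "('g, 'm) monoid_scheme \<Rightarrow> ('g \<times> 'g) mtx \<Rightarrow> ('g \<times> 'g) mtx \<Rightarrow> ('g \<times> 'g) mtx" where
  "Ad G \<Omega> X = \<Omega> \<odot>\<^bsub>carrier2 G\<^esub> X \<odot>\<^bsub>carrier2 G\<^esub> madj \<Omega>"

definition twisted_coprod ::
  "('g, 'm) monoid_scheme \<Rightarrow> ('g \<times> 'g) mtx \<Rightarrow> 'g mtx \<Rightarrow> ('g \<times> 'g) mtx" where
  "twisted_coprod G \<Omega> X = Ad G \<Omega> (coprod G X)"

definition twisted_antipode ::
  "('g, 'm) monoid_scheme \<Rightarrow> 'g mtx \<Rightarrow> 'g mtx \<Rightarrow> 'g mtx" where
  "twisted_antipode G u X = u \<odot>\<^bsub>carrier G\<^esub> antipode G X \<odot>\<^bsub>carrier G\<^esub> madj u"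

text \<open>\<open>\<Omega>\<^sup>u = (u\<^sup>* \<otimes> u\<^sup>*) \<Omega> \<Delta>(u)\<close>\<close>

definition cobound ::
  "('g, 'm) monoid_scheme \<Rightarrow> ('g \<times> 'g) mtx \<Rightarrow> 'g mtx \<Rightarrow> ('g \<times> 'g) mtx" where
  "cobound G \<Omega> u = kron (madj u) (madj u) \<odot>\<^bsub>carrier2 G\<^esub> \<Omega> \<odot>\<^bsub>carrier2 G\<^esub> coprod G u"

text \<open>\<open>\<Sigma>(\<kappa> \<otimes> \<kappa>)(\<Omega>\<^sup>*)\<close>\<close>

definition flip_antipode ::
  "('g, 'm) monoid_scheme \<Rightarrow> ('g \<times> 'g) mtx \<Rightarrow> ('g \<times> 'g) mtx" where
  "flip_antipode G \<Omega> = flip (group_alg G)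
     (tensor_map (group_alg G) (group_alg G) (antipode G) (antipode G) (madj \<Omega>))"

definition co_involutive :: "('g, 'm) monoid_scheme \<Rightarrow> ('g \<times> 'g) mtx \<Rightarrow> 'g mtx \<Rightarrow> bool" where
  "co_involutive G \<Omega> u \<longleftrightarrow>
     unitary_in (carrier G) (group_alg G) u \<and> flip_antipode G \<Omega> = cobound G \<Omega> u"

definition pseudo_co_involutive ::
  "('g, 'm) monoid_scheme \<Rightarrow> ('g \<times> 'g) mtx \<Rightarrow> 'g mtx \<Rightarrow> bool" where
  "pseudo_co_involutive G \<Omega> u \<longleftrightarrow>
     unitary_in (carrier G) (group_alg G) u \<and>
     cobound G \<Omega> u \<odot>\<^bsub>carrier2 G\<^esub> madj (flip_antipode G \<Omega>)
       \<in> commutant (carrier2 G) (coprod G ` group_alg G)"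

section \<open>Lifting from an abelian subgroup\<close>

definition dual_group :: "('g, 'm) monoid_scheme \<Rightarrow> 'g set \<Rightarrow> ('g \<Rightarrow> complex) monoid" where
  "dual_group G H =
     \<lparr>carrier = {\<chi> \<in> extensional H. (\<forall>h\<in>H. cmod (\<chi> h) = 1) \<and>
                   (\<forall>h\<in>H. \<forall>k\<in>H. \<chi> (h \<otimes>\<^bsub>G\<^esub> k) = \<chi> h * \<chi> k)},
      monoid.mult = (\<lambda>\<chi> \<psi>. \<lambda>h\<in>H. \<chi> h * \<psi> h),
      one = (\<lambda>h\<in>H. 1)\<rparr>"

text \<open>
  The projections \<open>P\<^sub>x\<close>: the last clause determines them uniquely, by Fourier inversion on \<open>H\<close>.
\<close>

definition dual_projections ::
  "('g, 'm) monoid_scheme \<Rightarrow> 'g set \<Rightarrow> (('g \<Rightarrow> complex) \<Rightarrow> 'g mtx) \<Rightarrow> bool" where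
  "dual_projections G H P \<longleftrightarrow>
     (\<forall>x\<in>carrier (dual_group G H). P x \<in> group_cstar G H \<and>
        madj (P x) = P x \<and> P x \<odot>\<^bsub>carrier G\<^esub> P x = P x) \<and>
     (\<forall>x\<in>carrier (dual_group G H). \<forall>y\<in>carrier (dual_group G H).
        x \<noteq> y \<longrightarrow> P x \<odot>\<^bsub>carrier G\<^esub> P y = 0) \<and>
     (\<forall>h\<in>H. lreg G h = (\<Sum>x\<in>carrier (dual_group G H). x h \<cdot> P x))"

definition lifted_from :: "('g, 'm) monoid_scheme \<Rightarrow> 'g set \<Rightarrow> ('g \<times> 'g) mtx \<Rightarrow> bool" where
  "lifted_from G H \<Omega> \<longleftrightarrow> (\<exists>P \<omega>. dual_projections G H P \<and>
     (\<forall>x\<in>carrier (dual_group G H). \<forall>y\<in>carrier (dual_group G H). cmod (\<omega> x y) = 1) \<and>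
     \<Omega> = (\<Sum>x\<in>carrier (dual_group G H). \<Sum>y\<in>carrier (dual_group G H).
            \<omega> x y \<cdot> kron (P x) (P y)))"

text \<open>\<open>u = m(id \<otimes> \<kappa>)\<Omega>\<close>; for the lifted \<open>\<Omega>\<close> this is \<open>\<Sum>x. \<omega>(x, x\<^sup>-\<^sup>1) P\<^sub>x\<close>.\<close>

definition lift_unitary :: "('g, 'm) monoid_scheme \<Rightarrow> ('g \<times> 'g) mtx \<Rightarrow> 'g mtx" where
  "lift_unitary G = tensor_lift (group_alg G) (group_alg G) (\<lambda>a b. a \<odot>\<^bsub>carrier G\<^esub> antipode G b)"

section \<open>The linear extensions have the prescribed values\<close>

lemma sum_mtx_apply: "(\<Sum>k\<in>K. f k :: 'i mtx) i j = (\<Sum>k\<in>K. f k i j)"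
  by (induction K rule: infinite_finite_induct) auto

lemma lreg_mult:
  assumes "group G" "finite (carrier G)" "g \<in> carrier G" "h \<in> carrier G"
  shows "lreg G g \<odot>\<^bsub>carrier G\<^esub> lreg G h = lreg G (g \<otimes>\<^bsub>G\<^esub> h)"
proof (intro ext)
  interpret group G by fact
  fix i j
  show "(lreg G g \<odot>\<^bsub>carrier G\<^esub> lreg G h) i j = lreg G (g \<otimes>\<^bsub>G\<^esub> h) i j"
  proof (cases "j \<in> carrier G")
    case True
    have "(lreg G g \<odot>\<^bsub>carrier G\<^esub> lreg G h) i j =
        (\<Sum>k\<in>carrier G. if k = h \<otimes>\<^bsub>G\<^esub> j then (if i = g \<otimes>\<^bsub>G\<^esub> k then 1 else 0) else 0)"
      unfolding mmult_def lreg_def using True by (intro sum.cong) auto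
    also have "\<dots> = lreg G (g \<otimes>\<^bsub>G\<^esub> h) i j"
      using True assms(2-4) by (simp add: lreg_def m_assoc)
    finally show ?thesis .
  qed (auto simp: mmult_def lreg_def)
qed

lemma lreg_adj:
  assumes "group G" "g \<in> carrier G"
  shows "madj (lreg G g) = lreg G (inv\<^bsub>G\<^esub> g)"
proof (intro ext)
  interpret group G by fact
  fix i j
  show "madj (lreg G g) i j = lreg G (inv\<^bsub>G\<^esub> g) i j"
    unfolding madj_def lreg_def using assms(2)
    by (cases "i \<in> carrier G"; cases "j \<in> carrier G") (auto simp only: inv_solve_left inv_closed m_closed if_False if_True simp_thms complex_cnj_one complex_cnj_zero split: if_splits)
qed

lemma lreg_one: "group G \<Longrightarrow> lreg G \<one>\<^bsub>G\<^esub> = mone (carrier G)"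
  by (auto simp: fun_eq_iff lreg_def mone_def group.is_monoid monoid.l_one)

lemma lreg_in_group_alg: "g \<in> H \<Longrightarrow> lreg G g \<in> group_cstar G H"
  unfolding group_cstar_def cstar_generated_def by (meson hull_inc imageI)

lemma lreg_coeff:
  assumes "group G" "h \<in> carrier G"
  shows "lreg G h g \<one>\<^bsub>G\<^esub> = (if g = h then 1 else 0)"
proof -
  interpret group G by fact
  show ?thesis using assms(2) by (auto simp: lreg_def)
qed

lemma group_alg_expansion:
  fixes G :: "('g, 'm) monoid_scheme"
  assumes "group G" "finite (carrier G)" "X \<in> group_alg G"
  shows "X = (\<Sum>g\<in>carrier G. X g \<one>\<^bsub>G\<^esub> \<cdot> lreg G g)"
proof -
  interpret group G by fact
  define T where "T = {X. \<exists>c. X = (\<Sum>g\<in>carrier G. c g \<cdot> lreg G g)}"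
  have TI: "(\<Sum>g\<in>carrier G. c g \<cdot> lreg G g) \<in> T" for c
    unfolding T_def by blast
  have lT: "lreg G h \<in> T" if "h \<in> carrier G" for h
  proof -
    have "lreg G h = (\<Sum>g\<in>carrier G. (if g = h then 1 else 0) \<cdot> lreg G g)"
      using that assms(2)
      by (auto simp: fun_eq_iff sum_mtx_apply msmult_def if_distrib[of "\<lambda>x. x * _"] cong: if_cong)
    then show ?thesis using TI by metis
  qed
  have add: "X + Y \<in> T" if "X \<in> T" "Y \<in> T" for X Y
  proof -
    from that obtain c d where "X = (\<Sum>g\<in>carrier G. c g \<cdot> lreg G g)"
      "Y = (\<Sum>g\<in>carrier G. d g \<cdot> lreg G g)" unfolding T_def by blast
    then have "X + Y = (\<Sum>g\<in>carrier G. (c g + d g) \<cdot> lreg G g)"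
      by (auto simp: fun_eq_iff sum_mtx_apply msmult_def sum.distrib algebra_simps)
    then show ?thesis using TI by metis
  qed
  have sm: "c \<cdot> X \<in> T" if "X \<in> T" for X c
  proof -
    from that obtain d where "X = (\<Sum>g\<in>carrier G. d g \<cdot> lreg G g)" unfolding T_def by blast
    then have "c \<cdot> X = (\<Sum>g\<in>carrier G. (c * d g) \<cdot> lreg G g)"
      by (auto simp: fun_eq_iff sum_mtx_apply msmult_def sum_distrib_left algebra_simps)
    then show ?thesis using TI by metis
  qed
  have zero: "0 \<in> T"
  proof -
    have "(\<Sum>g\<in>carrier G. 0 \<cdot> lreg G g) = 0"
      unfolding fun_eq_iff sum_mtx_apply msmult_def zero_fun_apply by simp
    then show ?thesis using TI[of "\<lambda>_. 0"] by simp
  qed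
  have sumT: "(\<Sum>k\<in>K. f k) \<in> T" if "\<And>k. k \<in> K \<Longrightarrow> f k \<in> T"
    for K :: "'g set" and f :: "'g \<Rightarrow> 'g mtx"
    using that by (induction K rule: infinite_finite_induct) (auto simp: zero add)
  have mu: "X \<odot>\<^bsub>carrier G\<^esub> Y \<in> T" if "X \<in> T" "Y \<in> T" for X Y
  proof -
    from that obtain c d where X: "X = (\<Sum>g\<in>carrier G. c g \<cdot> lreg G g)"
      and Y: "Y = (\<Sum>g\<in>carrier G. d g \<cdot> lreg G g)" unfolding T_def by blast
    have "X \<odot>\<^bsub>carrier G\<^esub> Y =
        (\<Sum>g\<in>carrier G. \<Sum>h\<in>carrier G. (c g * d h) \<cdot> (lreg G g \<odot>\<^bsub>carrier G\<^esub> lreg G h))"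
      (is "?L = ?R")
    proof (intro ext)
      fix i j
      have "?L i j = (\<Sum>k\<in>carrier G. \<Sum>g\<in>carrier G. \<Sum>h\<in>carrier G.
              c g * lreg G g i k * (d h * lreg G h k j))"
        by (simp add: X Y mmult_def sum_mtx_apply msmult_def sum_product)
      also have "\<dots> = (\<Sum>g\<in>carrier G. \<Sum>k\<in>carrier G. \<Sum>h\<in>carrier G.
              c g * lreg G g i k * (d h * lreg G h k j))"
        by (rule sum.swap)
      also have "\<dots> = (\<Sum>g\<in>carrier G. \<Sum>h\<in>carrier G. \<Sum>k\<in>carrier G.
              c g * lreg G g i k * (d h * lreg G h k j))"
        by (intro sum.cong refl sum.swap)
      also have "\<dots> = ?R i j"
        by (simp add: mmult_def sum_mtx_apply msmult_def sum_distrib_left algebra_simps)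
      finally show "?L i j = ?R i j" .
    qed
    moreover have "?R \<in> T"
      using assms(1,2) by (intro sumT sm) (simp add: lreg_mult lT)
    ultimately show ?thesis by simp
  qed
  have ad: "madj X \<in> T" if "X \<in> T" for X
  proof -
    from that obtain c where X: "X = (\<Sum>g\<in>carrier G. c g \<cdot> lreg G g)" unfolding T_def by blast
    then have "madj X = (\<Sum>g\<in>carrier G. cnj (c g) \<cdot> madj (lreg G g))"
      by (auto simp: fun_eq_iff sum_mtx_apply msmult_def madj_def)
    also have "\<dots> \<in> T" using assms(1) by (intro sumT sm) (simp add: lreg_adj lT)
    finally show ?thesis .
  qed
  have "T \<subseteq> mats (carrier G)"
  proof
    fix X assume "X \<in> T"
    then obtain c where X: "X = (\<Sum>g\<in>carrier G. c g \<cdot> lreg G g)" unfolding T_def by blast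
    have "X i j = 0" if "\<not> (i \<in> carrier G \<and> j \<in> carrier G)" for i j
      using that unfolding X sum_mtx_apply msmult_def lreg_def by (intro sum.neutral) auto
    then show "X \<in> mats (carrier G)" unfolding mats_def by blast
  qed
  then have "star_subalgebra (carrier G) T"
    unfolding star_subalgebra_def using assms(2) add sm mu ad lT[of "\<one>\<^bsub>G\<^esub>"] lreg_one[OF assms(1)]
    by auto
  then have "group_alg G \<subseteq> T"
    unfolding group_cstar_def cstar_generated_def using lT by (intro hull_minimal) auto
  then obtain c where X: "X = (\<Sum>g\<in>carrier G. c g \<cdot> lreg G g)"
    using assms(3) unfolding T_def by blast
  have "X h \<one>\<^bsub>G\<^esub> = c h" if "h \<in> carrier G" for h
  proof -
    have "X h \<one>\<^bsub>G\<^esub> = (\<Sum>g\<in>carrier G. if g = h then c h else 0)"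
      unfolding X sum_mtx_apply msmult_def
      using that lreg_coeff[OF assms(1)] by (intro sum.cong) auto
    then show ?thesis using that assms(2) by simp
  qed
  then show ?thesis by (subst X) (auto intro!: sum.cong)
qed

lemma lreg_extension_values:
  assumes "group G" "finite (carrier G)" "h \<in> carrier G"
  shows "coprod G (lreg G h) = kron (lreg G h) (lreg G h)"
    and "counit G (lreg G h) = 1"
    and "antipode G (lreg G h) = lreg G (inv\<^bsub>G\<^esub> h)"
    and "extend_aut G \<alpha> (lreg G h) = lreg G (\<alpha> h)"
proof -
  have *: "(\<Sum>g\<in>carrier G. lreg G h g \<one>\<^bsub>G\<^esub> \<cdot> f g) = f h" for f :: "'a \<Rightarrow> 'k mtx"
  proof (intro ext)
    fix i j
    have "(\<Sum>g\<in>carrier G. lreg G h g \<one>\<^bsub>G\<^esub> \<cdot> f g) i j = (\<Sum>g\<in>carrier G. if g = h then f h i j else 0)"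
      unfolding sum_mtx_apply msmult_def
      using assms lreg_coeff[OF assms(1)] by (intro sum.cong) auto
    then show "(\<Sum>g\<in>carrier G. lreg G h g \<one>\<^bsub>G\<^esub> \<cdot> f g) i j = f h i j" using assms by simp
  qed
  show "coprod G (lreg G h) = kron (lreg G h) (lreg G h)"
    "antipode G (lreg G h) = lreg G (inv\<^bsub>G\<^esub> h)"
    "extend_aut G \<alpha> (lreg G h) = lreg G (\<alpha> h)"
    by (simp_all add: coprod_def antipode_def extend_aut_def *)
  have "counit G (lreg G h) = (\<Sum>g\<in>carrier G. if g = h then 1 else 0)"
    unfolding counit_def using assms lreg_coeff[OF assms(1)] by (intro sum.cong) auto
  then show "counit G (lreg G h) = 1" using assms by simp
qed

end

theory Submission
  imports Defs
begin

text \<open>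
  The hypothesis on \<open>Ad \<Omega>\<close> gives the compatibility of \<open>\<alpha>\<close> with the twisted coproduct at once:
  \<open>\<alpha> \<otimes> \<alpha>\<close> intertwines the untwisted \<open>\<Delta>\<close> (this is clear on every \<open>\<lambda>(g)\<close>), hence
  \<open>(\<alpha> \<otimes> \<alpha>)(\<Omega> \<Delta>(x) \<Omega>\<^sup>*) = \<Omega> (\<alpha> \<otimes> \<alpha>)(\<Delta>(x)) \<Omega>\<^sup>* = \<Omega> \<Delta>(\<alpha>(x)) \<Omega>\<^sup>*\<close>.
  The counit is the sum of the coefficients of the \<open>\<lambda>(g)\<close>, which \<open>\<alpha>\<close> permutes.

  The twisted antipode involves \<open>u\<close>, and \<open>\<alpha>(u)\<close> may differ from \<open>u\<close>. No comparison of the two is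
  made: \<open>\<alpha>\<close> commutes with the antipode because antipodes are unique. For a linear map \<open>f\<close> that
  respects unit, product, coproduct and counit, \<open>f \<circ> \<kappa>\<close> is a left and \<open>\<kappa> \<circ> f\<close> a right inverse of \<open>f\<close>
  for the convolution product on linear maps; this product is associative, since the coproduct is
  coassociative, so the two inverses agree (\<open>convolution_inverse_unique\<close>,
  \<open>bialgebra_endomorphism_commutes_antipode\<close>). The antipode axioms come with the twisted Kac algebra.

  If \<open>\<alpha>\<close> is the identity on \<open>H\<close>, its fixed points form a *-subalgebra containing \<open>\<lambda>(H)\<close>, hence
  containing the algebra generated by \<open>\<lambda>(H)\<close>. So \<open>\<alpha> \<otimes> \<alpha>\<close> fixes \<open>\<Omega>\<close>, and being a
  *-homomorphism it commutes with \<open>Ad \<Omega>\<close>.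

  Two devices make this concrete. The \<open>\<lambda>(g)\<close> are a basis whose coefficients can be read off the column
  of the unit, so an element \<open>T\<close> of the tensor square has coordinates \<open>T (g, h) (\<one>, \<one>)\<close>, and every
  bilinear map has a well-defined lift (\<open>tensor_lift_eq\<close>, \<open>tensor_lift_coords\<close>). And on the group
  algebra \<open>\<alpha>\<close> is conjugation by a permutation matrix, that is, a relabelling of matrix entries; in
  this form multiplicativity of \<open>\<alpha>\<close> and of \<open>\<alpha> \<otimes> \<alpha>\<close> is just reindexing of a sum.
\<close>


section \<open>Matrix arithmetic\<close>

lemma msmult_sum: "c \<cdot> (\<Sum>k\<in>K. f k) = (\<Sum>k\<in>K. c \<cdot> f k)"
  by (simp add: fun_eq_iff sum_mtx_apply msmult_def sum_distrib_left)

lemma sum_msmult: "(\<Sum>k\<in>K. c k) \<cdot> X = (\<Sum>k\<in>K. c k \<cdot> X)"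
  by (simp add: fun_eq_iff sum_mtx_apply msmult_def sum_distrib_right)

lemma msmult_msmult: "c \<cdot> d \<cdot> X = (c * d) \<cdot> X"
  by (simp add: fun_eq_iff msmult_def)

lemma msmult_zero: "0 \<cdot> X = 0"
  unfolding fun_eq_iff msmult_def zero_fun_apply by simp

lemma mmult_add_left: "(X + Y) \<odot>\<^bsub>I\<^esub> Z = X \<odot>\<^bsub>I\<^esub> Z + Y \<odot>\<^bsub>I\<^esub> Z"
  by (simp add: fun_eq_iff mmult_def sum.distrib algebra_simps)

lemma mmult_add_right: "Z \<odot>\<^bsub>I\<^esub> (X + Y) = Z \<odot>\<^bsub>I\<^esub> X + Z \<odot>\<^bsub>I\<^esub> Y"
  by (simp add: fun_eq_iff mmult_def sum.distrib algebra_simps)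

lemma mmult_msmult_left: "(c \<cdot> X) \<odot>\<^bsub>I\<^esub> Y = c \<cdot> (X \<odot>\<^bsub>I\<^esub> Y)"
  by (simp add: fun_eq_iff mmult_def msmult_def sum_distrib_left algebra_simps)

lemma mmult_msmult_right: "X \<odot>\<^bsub>I\<^esub> (c \<cdot> Y) = c \<cdot> (X \<odot>\<^bsub>I\<^esub> Y)"
  by (simp add: fun_eq_iff mmult_def msmult_def sum_distrib_left algebra_simps)

lemma mmult_sum_left: "(\<Sum>k\<in>K. f k) \<odot>\<^bsub>I\<^esub> Y = (\<Sum>k\<in>K. f k \<odot>\<^bsub>I\<^esub> Y)"
  unfolding fun_eq_iff mmult_def sum_mtx_apply sum_distrib_right
  by (intro allI sum.swap)

lemma mmult_sum_right: "Y \<odot>\<^bsub>I\<^esub> (\<Sum>k\<in>K. f k) = (\<Sum>k\<in>K. Y \<odot>\<^bsub>I\<^esub> f k)"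
  unfolding fun_eq_iff mmult_def sum_mtx_apply sum_distrib_left
  by (intro allI sum.swap)

lemma mmult_assoc: "(X \<odot>\<^bsub>I\<^esub> Y) \<odot>\<^bsub>I\<^esub> Z = X \<odot>\<^bsub>I\<^esub> (Y \<odot>\<^bsub>I\<^esub> Z)"
proof (intro ext)
  fix i j
  have "((X \<odot>\<^bsub>I\<^esub> Y) \<odot>\<^bsub>I\<^esub> Z) i j = (\<Sum>l\<in>I. \<Sum>k\<in>I. X i k * Y k l * Z l j)"
    by (simp add: mmult_def sum_distrib_right)
  also have "\<dots> = (\<Sum>k\<in>I. \<Sum>l\<in>I. X i k * Y k l * Z l j)"
    by (rule sum.swap)
  finally show "((X \<odot>\<^bsub>I\<^esub> Y) \<odot>\<^bsub>I\<^esub> Z) i j = (X \<odot>\<^bsub>I\<^esub> (Y \<odot>\<^bsub>I\<^esub> Z)) i j"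
    by (simp add: mmult_def sum_distrib_left mult.assoc)
qed

lemma mmult_mone_right:
  assumes "finite I" "X \<in> mats I"
  shows "X \<odot>\<^bsub>I\<^esub> mone I = X"
proof (intro ext)
  fix i j
  have "(X \<odot>\<^bsub>I\<^esub> mone I) i j = (\<Sum>k\<in>I. if k = j then X i j else 0)"
    unfolding mmult_def mone_def by (intro sum.cong) auto
  then show "(X \<odot>\<^bsub>I\<^esub> mone I) i j = X i j"
    using assms by (auto simp: mats_def)
qed

lemma mmult_mone_left:
  assumes "finite I" "X \<in> mats I"
  shows "mone I \<odot>\<^bsub>I\<^esub> X = X"
proof (intro ext)
  fix i j
  have "(mone I \<odot>\<^bsub>I\<^esub> X) i j = (\<Sum>k\<in>I. if k = i then X i j else 0)"
    unfolding mmult_def mone_def by (intro sum.cong) auto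
  then show "(mone I \<odot>\<^bsub>I\<^esub> X) i j = X i j"
    using assms by (auto simp: mats_def)
qed

lemma madj_sum: "madj (\<Sum>k\<in>K. f k) = (\<Sum>k\<in>K. madj (f k))"
  by (simp add: fun_eq_iff madj_def sum_mtx_apply)

lemma kron_mmult: "kron X Y \<odot>\<^bsub>I \<times> J\<^esub> kron Z W = kron (X \<odot>\<^bsub>I\<^esub> Z) (Y \<odot>\<^bsub>J\<^esub> W)"
proof (intro ext)
  fix p q
  have "(kron X Y \<odot>\<^bsub>I \<times> J\<^esub> kron Z W) p q =
      (\<Sum>k\<in>I. \<Sum>l\<in>J. X (fst p) k * Y (snd p) l * (Z k (fst q) * W l (snd q)))"
    by (simp add: mmult_def kron_def sum.cartesian_product case_prod_beta)
  also have "\<dots> = kron (X \<odot>\<^bsub>I\<^esub> Z) (Y \<odot>\<^bsub>J\<^esub> W) p q"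
    unfolding mmult_def kron_def sum_product by (intro sum.cong refl) (simp only: mult_ac)
  finally show "(kron X Y \<odot>\<^bsub>I \<times> J\<^esub> kron Z W) p q = kron (X \<odot>\<^bsub>I\<^esub> Z) (Y \<odot>\<^bsub>J\<^esub> W) p q" .
qed

lemma madj_kron: "madj (kron X Y) = kron (madj X) (madj Y)"
  by (simp add: fun_eq_iff madj_def kron_def)

lemma kron_msmult_left: "kron (c \<cdot> X) Y = c \<cdot> kron X Y"
  by (simp add: fun_eq_iff kron_def msmult_def)

lemma kron_msmult_right: "kron X (c \<cdot> Y) = c \<cdot> kron X Y"
  by (simp add: fun_eq_iff kron_def msmult_def)

lemma kron_add_left: "kron (X + Y) Z = kron X Z + kron Y Z"
  by (simp add: fun_eq_iff kron_def algebra_simps)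

lemma kron_add_right: "kron Z (X + Y) = kron Z X + kron Z Y"
  by (simp add: fun_eq_iff kron_def algebra_simps)


section \<open>Subalgebras, linear and bilinear maps\<close>

lemma star_subalgebraD:
  assumes "star_subalgebra I A"
  shows star_subalgebra_finite: "finite I"
    and star_subalgebra_mats: "X \<in> A \<Longrightarrow> X \<in> mats I"
    and star_subalgebra_mone: "mone I \<in> A"
    and star_subalgebra_add: "X \<in> A \<Longrightarrow> Y \<in> A \<Longrightarrow> X + Y \<in> A"
    and star_subalgebra_mmult: "X \<in> A \<Longrightarrow> Y \<in> A \<Longrightarrow> X \<odot>\<^bsub>I\<^esub> Y \<in> A"
    and star_subalgebra_madj: "X \<in> A \<Longrightarrow> madj X \<in> A"
    and star_subalgebra_msmult: "X \<in> A \<Longrightarrow> c \<cdot> X \<in> A"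
  using assms unfolding star_subalgebra_def by auto

lemma star_subalgebra_zero: "star_subalgebra I A \<Longrightarrow> (0 :: 'i mtx) \<in> A"
  using star_subalgebra_msmult[OF _ star_subalgebra_mone, where c = 0] by (simp add: msmult_zero)

lemma star_subalgebra_sum:
  assumes "star_subalgebra I A" "\<And>k. k \<in> K \<Longrightarrow> f k \<in> A"
  shows "(\<Sum>k\<in>K. f k) \<in> A"
  using assms(2)
  by (induction K rule: infinite_finite_induct)
    (simp_all add: star_subalgebra_zero[OF assms(1)] star_subalgebra_add[OF assms(1)])

lemma matsI: "(\<And>i j. \<not> (i \<in> I \<and> j \<in> I) \<Longrightarrow> X i j = 0) \<Longrightarrow> X \<in> mats I"
  unfolding mats_def by blast

lemma matsD: "X \<in> mats I \<Longrightarrow> \<not> (i \<in> I \<and> j \<in> I) \<Longrightarrow> X i j = 0"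
  unfolding mats_def by blast

lemma star_subalgebra_full:
  assumes "finite I"
  shows "star_subalgebra I (mats I)"
  unfolding star_subalgebra_def
proof (intro conjI ballI allI subset_refl assms)
  show "mone I \<in> mats I"
    by (rule matsI) (auto simp: mone_def)
next
  fix X Y :: "'a mtx" and c :: complex
  assume X: "X \<in> mats I" and Y: "Y \<in> mats I"
  show "X + Y \<in> mats I"
    by (rule matsI) (simp add: matsD[OF X] matsD[OF Y])
  show "X \<odot>\<^bsub>I\<^esub> Y \<in> mats I"
  proof (rule matsI)
    fix i j assume ij: "\<not> (i \<in> I \<and> j \<in> I)"
    have "X i k * Y k j = 0" for k
      using ij matsD[OF X, of i k] matsD[OF Y, of k j] by auto
    then show "(X \<odot>\<^bsub>I\<^esub> Y) i j = 0"
      unfolding mmult_def by (intro sum.neutral ballI)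
  qed
next
  fix X :: "'a mtx" and c :: complex
  assume X: "X \<in> mats I"
  show "madj X \<in> mats I"
    by (rule matsI, unfold madj_def) (metis matsD[OF X] complex_cnj_zero)
  show "c \<cdot> X \<in> mats I"
    by (rule matsI) (simp add: msmult_def matsD[OF X])
qed

lemma star_subalgebra_Inter:
  assumes "\<T> \<noteq> {}" "\<And>A. A \<in> \<T> \<Longrightarrow> star_subalgebra I A"
  shows "star_subalgebra I (\<Inter>\<T>)"
proof -
  obtain A where "A \<in> \<T>" using assms(1) by blast
  then have "finite I" "\<Inter>\<T> \<subseteq> mats I"
    using assms(2)[of A] unfolding star_subalgebra_def by auto
  then show ?thesis
    unfolding star_subalgebra_def
    by (intro conjI ballI allI InterI) (auto intro: star_subalgebraD[OF assms(2)])
qed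

lemma star_subalgebra_cstar_generated:
  assumes "finite I" "S \<subseteq> mats I"
  shows "star_subalgebra I (cstar_generated I S)"
  unfolding cstar_generated_def hull_def
  \<comment> \<open>The full matrix algebra shows that the family to be intersected is nonempty.\<close>
  using star_subalgebra_full[OF assms(1)] assms(2) by (intro star_subalgebra_Inter) auto

lemma linear_mapD:
  assumes "linear_map A f"
  shows linear_map_add: "X \<in> A \<Longrightarrow> Y \<in> A \<Longrightarrow> f (X + Y) = f X + f Y"
    and linear_map_msmult: "X \<in> A \<Longrightarrow> f (c \<cdot> X) = c \<cdot> f X"
  using assms unfolding linear_map_def by auto

lemma linear_map_sum:
  assumes A: "star_subalgebra I A" and f: "linear_map A f" and x: "\<And>k. k \<in> K \<Longrightarrow> x k \<in> A"
  shows "f (\<Sum>k\<in>K. x k) = (\<Sum>k\<in>K. f (x k))"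
proof -
  have "f 0 = 0"
    using linear_map_msmult[OF f star_subalgebra_zero[OF A], of 0] by (simp add: msmult_zero)
  then show ?thesis
    using x by (induction K rule: infinite_finite_induct)
      (simp_all add: linear_map_add[OF f] star_subalgebra_sum[OF A])
qed

lemma linear_map_compose:
  "linear_map A f \<Longrightarrow> f \<in> A \<rightarrow> B \<Longrightarrow> linear_map B g \<Longrightarrow> linear_map A (\<lambda>x. g (f x))"
  unfolding linear_map_def Pi_iff by simp

definition bilinear_on ::
  "'i mtx set \<Rightarrow> 'j mtx set \<Rightarrow> ('i mtx \<Rightarrow> 'j mtx \<Rightarrow> 'k mtx) \<Rightarrow> bool" where
  "bilinear_on A B \<phi> \<longleftrightarrow>
     (\<forall>b\<in>B. linear_map A (\<lambda>a. \<phi> a b)) \<and> (\<forall>a\<in>A. linear_map B (\<phi> a))"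

lemma bilinear_on_mmult:
  assumes "linear_map A f" "linear_map B g"
  shows "bilinear_on A B (\<lambda>a b. f a \<odot>\<^bsub>I\<^esub> g b)"
  using assms unfolding bilinear_on_def linear_map_def
  by (simp add: mmult_add_left mmult_add_right mmult_msmult_left mmult_msmult_right)

lemma bilinear_on_kron:
  assumes "linear_map A f" "linear_map B g"
  shows "bilinear_on A B (\<lambda>a b. kron (f a) (g b))"
  using assms unfolding bilinear_on_def linear_map_def
  by (simp add: kron_add_left kron_add_right kron_msmult_left kron_msmult_right)

lemma linear_map_id: "linear_map A (\<lambda>x. x)"
  by (simp add: linear_map_def)


section \<open>The algebraic tensor product\<close>

lemma tensorI:
  fixes n :: nat
  assumes "\<forall>k<n. a k \<in> A \<and> b k \<in> B" "T = (\<Sum>k<n. kron (a k) (b k))"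
  shows "T \<in> tensor A B"
  using assms unfolding tensor_def by (intro CollectI exI[of _ n] exI[of _ a] exI[of _ b]) simp

lemma tensor_zero: "0 \<in> tensor A B"
  unfolding tensor_def by (auto intro!: exI[of _ 0])

lemma tensor_kron: "a \<in> A \<Longrightarrow> b \<in> B \<Longrightarrow> kron a b \<in> tensor A B"
  unfolding tensor_def
  by (auto intro!: exI[of _ "1::nat"] exI[of _ "\<lambda>_. a"] exI[of _ "\<lambda>_. b"])

lemma tensor_add:
  assumes "S \<in> tensor A B" "T \<in> tensor A B"
  shows "S + T \<in> tensor A B"
proof -
  obtain n :: nat and a b where ab: "\<forall>k<n. a k \<in> A \<and> b k \<in> B" and S: "S = (\<Sum>k<n. kron (a k) (b k))"
    using assms(1) unfolding tensor_def by blast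
  obtain m :: nat and c d where cd: "\<forall>k<m. c k \<in> A \<and> d k \<in> B" and T: "T = (\<Sum>k<m. kron (c k) (d k))"
    using assms(2) unfolding tensor_def by blast
  let ?a = "\<lambda>k. if k < n then a k else c (k - n)"
  let ?b = "\<lambda>k. if k < n then b k else d (k - n)"
  have "{..<n + m} = {..<n} \<union> (\<lambda>k. n + k) ` {..<m}"
    by (auto simp: image_iff Bex_def) presburger
  then have "(\<Sum>k<n + m. kron (?a k) (?b k)) =
      (\<Sum>k<n. kron (?a k) (?b k)) + (\<Sum>k\<in>(\<lambda>k. n + k) ` {..<m}. kron (?a k) (?b k))"
    by (simp only:) (rule sum.union_disjoint, auto)
  also have "\<dots> = S + T"
    by (simp add: S T sum.reindex o_def)
  finally have "S + T = (\<Sum>k<n + m. kron (?a k) (?b k))" by simp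
  moreover have "\<forall>k<n + m. ?a k \<in> A \<and> ?b k \<in> B" using ab cd by auto
  ultimately show ?thesis by (intro tensorI[of "n + m" ?a A ?b B])
qed

lemma tensor_sum:
  assumes "\<And>k. k \<in> K \<Longrightarrow> f k \<in> tensor A B"
  shows "(\<Sum>k\<in>K. f k) \<in> tensor A B"
  using assms by (induction K rule: infinite_finite_induct) (simp_all add: tensor_zero tensor_add)

lemma tensor_msmult:
  assumes A: "star_subalgebra I A" and T: "T \<in> tensor A B"
  shows "c \<cdot> T \<in> tensor A B"
proof -
  obtain n :: nat and a b where ab: "\<forall>k<n. a k \<in> A \<and> b k \<in> B" and T': "T = (\<Sum>k<n. kron (a k) (b k))"
    using T unfolding tensor_def by blast
  have "c \<cdot> T = (\<Sum>k<n. kron (c \<cdot> a k) (b k))"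
    by (simp add: T' msmult_sum kron_msmult_left)
  also have "\<dots> \<in> tensor A B"
    using ab by (intro tensor_sum tensor_kron star_subalgebra_msmult[OF A]) auto
  finally show ?thesis .
qed

lemma tensor_mmult:
  assumes A: "star_subalgebra I A" and B: "star_subalgebra J B"
    and S: "S \<in> tensor A B" and T: "T \<in> tensor A B"
  shows "S \<odot>\<^bsub>I \<times> J\<^esub> T \<in> tensor A B"
proof -
  obtain n :: nat and a b where ab: "\<forall>k<n. a k \<in> A \<and> b k \<in> B" and S': "S = (\<Sum>k<n. kron (a k) (b k))"
    using S unfolding tensor_def by blast
  obtain m :: nat and c d where cd: "\<forall>k<m. c k \<in> A \<and> d k \<in> B" and T': "T = (\<Sum>k<m. kron (c k) (d k))"
    using T unfolding tensor_def by blast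
  have "S \<odot>\<^bsub>I \<times> J\<^esub> T = (\<Sum>k<n. \<Sum>l<m. kron (a k \<odot>\<^bsub>I\<^esub> c l) (b k \<odot>\<^bsub>J\<^esub> d l))"
    unfolding S' T' mmult_sum_left by (simp only: mmult_sum_right kron_mmult)
  also have "\<dots> \<in> tensor A B"
    using ab cd
    by (intro tensor_sum tensor_kron star_subalgebra_mmult[OF A] star_subalgebra_mmult[OF B]) auto
  finally show ?thesis .
qed

lemma tensor_madj:
  assumes A: "star_subalgebra I A" and B: "star_subalgebra J B" and T: "T \<in> tensor A B"
  shows "madj T \<in> tensor A B"
proof -
  obtain n :: nat and a b where ab: "\<forall>k<n. a k \<in> A \<and> b k \<in> B" and T': "T = (\<Sum>k<n. kron (a k) (b k))"
    using T unfolding tensor_def by blast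
  have "madj T = (\<Sum>k<n. kron (madj (a k)) (madj (b k)))"
    by (simp add: T' madj_sum madj_kron)
  also have "\<dots> \<in> tensor A B"
    using ab
    by (intro tensor_sum tensor_kron star_subalgebra_madj[OF A] star_subalgebra_madj[OF B]) auto
  finally show ?thesis .
qed

lemma tensor_mono: "A \<subseteq> A' \<Longrightarrow> B \<subseteq> B' \<Longrightarrow> tensor A B \<subseteq> tensor A' B'"
  unfolding tensor_def by blast


section \<open>Coordinates in the group algebra and its tensor square\<close>

locale finite_group = group G for G (structure) +
  assumes finite_carrier: "finite (carrier G)"
begin

lemma lreg_mats: "lreg G g \<in> mats (carrier G)" if "g \<in> carrier G"
  using that by (auto simp: mats_def lreg_def)

lemma star_subalgebra_group_cstar: "H \<subseteq> carrier G \<Longrightarrow> star_subalgebra (carrier G) (group_cstar G H)"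
  unfolding group_cstar_def
  using lreg_mats by (intro star_subalgebra_cstar_generated finite_carrier) auto

lemmas star_subalgebra_group_alg = star_subalgebra_group_cstar[OF subset_refl]

lemma expansion: "X \<in> group_alg G \<Longrightarrow> X = (\<Sum>g\<in>carrier G. X g \<one> \<cdot> lreg G g)"
  by (rule group_alg_expansion[OF is_group finite_carrier])

text \<open>
  A bilinear map on the group algebra is determined by its values on pairs of basis elements.
\<close>

lemma bilinear_coords:
  assumes \<phi>: "bilinear_on (group_alg G) (group_alg G) \<phi>" and a: "a \<in> group_alg G" and b: "b \<in> group_alg G"
  shows "\<phi> a b = (\<Sum>g\<in>carrier G. \<Sum>h\<in>carrier G. (a g \<one> * b h \<one>) \<cdot> \<phi> (lreg G g) (lreg G h))"
proof -
  note A = star_subalgebra_group_alg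
  have l: "lreg G g \<in> group_alg G" if "g \<in> carrier G" for g
    using that by (rule lreg_in_group_alg)
  have 1: "linear_map (group_alg G) (\<lambda>a. \<phi> a b)"
    using \<phi> b unfolding bilinear_on_def by blast
  have 2: "linear_map (group_alg G) (\<phi> (lreg G g))" if "g \<in> carrier G" for g
    using \<phi> l[OF that] unfolding bilinear_on_def by blast
  have "\<phi> a b = \<phi> (\<Sum>g\<in>carrier G. a g \<one> \<cdot> lreg G g) b"
    using expansion[OF a] by simp
  also have "\<dots> = (\<Sum>g\<in>carrier G. a g \<one> \<cdot> \<phi> (lreg G g) b)"
    using linear_map_sum[OF A 1, of "carrier G" "\<lambda>g. a g \<one> \<cdot> lreg G g"]
    by (simp add: star_subalgebra_msmult[OF A] l linear_map_msmult[OF 1])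
  also have "\<dots> = (\<Sum>g\<in>carrier G. \<Sum>h\<in>carrier G. (a g \<one> * b h \<one>) \<cdot> \<phi> (lreg G g) (lreg G h))"
  proof (rule sum.cong[OF refl])
    fix g assume g: "g \<in> carrier G"
    have "\<phi> (lreg G g) b = \<phi> (lreg G g) (\<Sum>h\<in>carrier G. b h \<one> \<cdot> lreg G h)"
      using expansion[OF b] by simp
    also have "\<dots> = (\<Sum>h\<in>carrier G. b h \<one> \<cdot> \<phi> (lreg G g) (lreg G h))"
      using linear_map_sum[OF A 2[OF g], of "carrier G" "\<lambda>h. b h \<one> \<cdot> lreg G h"]
      by (simp add: star_subalgebra_msmult[OF A] l linear_map_msmult[OF 2[OF g]])
    finally show "a g \<one> \<cdot> \<phi> (lreg G g) b =
        (\<Sum>h\<in>carrier G. (a g \<one> * b h \<one>) \<cdot> \<phi> (lreg G g) (lreg G h))"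
      by (simp add: msmult_sum msmult_msmult)
  qed
  finally show ?thesis .
qed

text \<open>
  The right-hand side mentions only \<open>T\<close>, so the left-hand side is the same for all ways of writing \<open>T\<close>
  as a sum of elementary tensors. This is what makes the definite description in
  \<open>tensor_lift\<close> meaningful.
\<close>

lemma sum_bilinear_coords:
  assumes \<phi>: "bilinear_on (group_alg G) (group_alg G) \<phi>"
    and ab: "\<forall>k<n. a k \<in> group_alg G \<and> b k \<in> group_alg G" and T: "T = (\<Sum>k<(n::nat). kron (a k) (b k))"
  shows "(\<Sum>k<n. \<phi> (a k) (b k)) =
    (\<Sum>g\<in>carrier G. \<Sum>h\<in>carrier G. T (g, h) (\<one>, \<one>) \<cdot> \<phi> (lreg G g) (lreg G h))"
proof -
  have "(\<Sum>k<n. \<phi> (a k) (b k)) =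
    (\<Sum>k<n. \<Sum>g\<in>carrier G. \<Sum>h\<in>carrier G. (a k g \<one> * b k h \<one>) \<cdot> \<phi> (lreg G g) (lreg G h))"
    using ab by (intro sum.cong refl bilinear_coords[OF \<phi>]) auto
  also have "\<dots> = (\<Sum>g\<in>carrier G. \<Sum>k<n. \<Sum>h\<in>carrier G. (a k g \<one> * b k h \<one>) \<cdot> \<phi> (lreg G g) (lreg G h))"
    by (rule sum.swap)
  also have "\<dots> = (\<Sum>g\<in>carrier G. \<Sum>h\<in>carrier G. \<Sum>k<n. (a k g \<one> * b k h \<one>) \<cdot> \<phi> (lreg G g) (lreg G h))"
    by (intro sum.cong refl sum.swap)
  finally show ?thesis by (simp add: T sum_mtx_apply kron_def sum_msmult)
qed

lemma tensor_lift_eq: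
  assumes \<phi>: "bilinear_on (group_alg G) (group_alg G) \<phi>"
    and ab: "\<forall>k<n. a k \<in> group_alg G \<and> b k \<in> group_alg G" and T: "T = (\<Sum>k<(n::nat). kron (a k) (b k))"
  shows "tensor_lift (group_alg G) (group_alg G) \<phi> T = (\<Sum>k<n. \<phi> (a k) (b k))"
  unfolding tensor_lift_def
proof (rule the_equality, goal_cases)
  case 1
  then show ?case using ab T by blast
next
  case (2 Y)
  then obtain m :: nat and c d where "\<forall>k<m. c k \<in> group_alg G \<and> d k \<in> group_alg G"
    "T = (\<Sum>k<(m::nat). kron (c k) (d k))" "Y = (\<Sum>k<m. \<phi> (c k) (d k))" by blast
  then show ?case
    using sum_bilinear_coords[OF \<phi> ab T] sum_bilinear_coords[OF \<phi>, of m c d T] by simp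
qed

lemma tensor_lift_coords:
  assumes \<phi>: "bilinear_on (group_alg G) (group_alg G) \<phi>" and T: "T \<in> tensor (group_alg G) (group_alg G)"
  shows "tensor_lift (group_alg G) (group_alg G) \<phi> T =
    (\<Sum>g\<in>carrier G. \<Sum>h\<in>carrier G. T (g, h) (\<one>, \<one>) \<cdot> \<phi> (lreg G g) (lreg G h))"
proof -
  obtain n :: nat and a b where ab: "\<forall>k<n. a k \<in> group_alg G \<and> b k \<in> group_alg G"
    and T': "T = (\<Sum>k<(n::nat). kron (a k) (b k))"
    using T unfolding tensor_def by blast
  show ?thesis
    using tensor_lift_eq[OF \<phi> ab T'] sum_bilinear_coords[OF \<phi> ab T'] by simp
qed

lemma lreg_coeff_one: "g \<in> carrier G \<Longrightarrow> lreg G g h \<one> = (if h = g then 1 else 0)"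
  by (rule lreg_coeff[OF is_group])


section \<open>Uniqueness of convolution inverses\<close>

text \<open>
  Coassociativity compared at the coefficient of \<open>\<lambda>(p) \<otimes> \<lambda>(s) \<otimes> \<lambda>(t)\<close>, which is the matrix entry in row
  \<open>(p, s, t)\<close> of the column \<open>(\<one>, \<one>, \<one>)\<close>.
\<close>

lemma coassociative_coords:
  assumes co: "coassociative (group_alg G) \<Delta>" and lin: "linear_map (group_alg G) \<Delta>"
    and ran: "\<Delta> \<in> group_alg G \<rightarrow> tensor (group_alg G) (group_alg G)"
    and X: "X \<in> group_alg G" and "p \<in> carrier G" "s \<in> carrier G" "t \<in> carrier G"
  shows "(\<Sum>r\<in>carrier G. \<Delta> X (r, t) (\<one>, \<one>) * \<Delta> (lreg G r) (p, s) (\<one>, \<one>)) =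
         (\<Sum>q\<in>carrier G. \<Delta> X (p, q) (\<one>, \<one>) * \<Delta> (lreg G q) (s, t) (\<one>, \<one>))"
proof -
  have T: "\<Delta> X \<in> tensor (group_alg G) (group_alg G)" using ran X by auto
  have eq: "massoc (tensor_map (group_alg G) (group_alg G) \<Delta> (\<lambda>x. x) (\<Delta> X)) =
      tensor_map (group_alg G) (group_alg G) (\<lambda>x. x) \<Delta> (\<Delta> X)"
    using co X unfolding coassociative_def by blast
  have "massoc (tensor_map (group_alg G) (group_alg G) \<Delta> (\<lambda>x. x) (\<Delta> X)) (p, s, t) (\<one>, \<one>, \<one>) =
      (\<Sum>r\<in>carrier G. \<Sum>q\<in>carrier G. if q = t then \<Delta> X (r, t) (\<one>, \<one>) * \<Delta> (lreg G r) (p, s) (\<one>, \<one>) else 0)"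
    unfolding tensor_map_def tensor_lift_coords[OF bilinear_on_kron[OF lin linear_map_id] T]
    unfolding massoc_def sum_mtx_apply msmult_def kron_def prod.case fst_conv snd_conv
    by (intro sum.cong refl) (auto simp: lreg_coeff_one)
  moreover have "tensor_map (group_alg G) (group_alg G) (\<lambda>x. x) \<Delta> (\<Delta> X) (p, s, t) (\<one>, \<one>, \<one>) =
      (\<Sum>r\<in>carrier G. if r = p then \<Sum>q\<in>carrier G. \<Delta> X (p, q) (\<one>, \<one>) * \<Delta> (lreg G q) (s, t) (\<one>, \<one>) else 0)"
    unfolding tensor_map_def tensor_lift_coords[OF bilinear_on_kron[OF linear_map_id lin] T]
    unfolding massoc_def sum_mtx_apply msmult_def kron_def prod.case fst_conv snd_conv
    by (intro sum.cong refl) (auto simp: lreg_coeff_one)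
  ultimately show ?thesis
    using eq assms(5-7) finite_carrier by simp
qed

text \<open>
  The usual argument \<open>g = g * (f * h) = (g * f) * h = h\<close> for the convolution product, whose unit is
  \<open>X \<mapsto> \<epsilon> X \<cdot> 1\<close>.
  In coordinates, both bracketings are sums of the products \<open>g(\<lambda>(p)) f(\<lambda>(s)) h(\<lambda>(t))\<close>; the
  coefficients agree by coassociativity.
\<close>

lemma convolution_inverse_unique:
  assumes co: "coassociative (group_alg G) \<Delta>" and lin: "linear_map (group_alg G) \<Delta>"
    and ran: "\<Delta> \<in> group_alg G \<rightarrow> tensor (group_alg G) (group_alg G)"
    and counit: "is_counit (carrier G) (group_alg G) \<Delta> \<epsilon>"
    and f: "linear_map (group_alg G) f"
    and g: "linear_map (group_alg G) g" "g \<in> group_alg G \<rightarrow> group_alg G"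
    and h: "linear_map (group_alg G) h" "h \<in> group_alg G \<rightarrow> group_alg G"
    and gf: "\<And>X. X \<in> group_alg G \<Longrightarrow>
      tensor_lift (group_alg G) (group_alg G) (\<lambda>a b. g a \<odot>\<^bsub>carrier G\<^esub> f b) (\<Delta> X) = \<epsilon> X \<cdot> mone (carrier G)"
    and fh: "\<And>X. X \<in> group_alg G \<Longrightarrow>
      tensor_lift (group_alg G) (group_alg G) (\<lambda>a b. f a \<odot>\<^bsub>carrier G\<^esub> h b) (\<Delta> X) = \<epsilon> X \<cdot> mone (carrier G)"
    and X: "X \<in> group_alg G"
  shows "g X = h X"
proof -
  let ?A = "group_alg G" and ?I = "carrier G"
  define c where "c = (\<lambda>p q. \<Delta> X (p, q) (\<one>, \<one>))"
  define D where "D = (\<lambda>r p q. \<Delta> (lreg G r) (p, q) (\<one>, \<one>))"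
  define W where "W = (\<lambda>p s t. g (lreg G p) \<odot>\<^bsub>?I\<^esub> (f (lreg G s) \<odot>\<^bsub>?I\<^esub> h (lreg G t)))"
  note A = star_subalgebra_group_alg
  have l: "lreg G p \<in> ?A" if "p \<in> ?I" for p using that by (rule lreg_in_group_alg)
  have T: "\<Delta> Y \<in> tensor ?A ?A" if "Y \<in> ?A" for Y using ran that by auto
  have \<epsilon>l: "bilinear_on ?A ?A (\<lambda>a b. \<epsilon> a \<cdot> b)" and \<epsilon>r: "bilinear_on ?A ?A (\<lambda>a b. \<epsilon> b \<cdot> a)"
    using counit unfolding is_counit_def bilinear_on_def linear_map_def
    by (auto simp: fun_eq_iff msmult_def algebra_simps)
  have gm: "g Y \<odot>\<^bsub>?I\<^esub> mone ?I = g Y" and hm: "mone ?I \<odot>\<^bsub>?I\<^esub> h Y = h Y" if "Y \<in> ?A" for Y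
    using g(2) h(2) that star_subalgebra_mats[OF A] finite_carrier
    by (auto intro!: mmult_mone_right mmult_mone_left)
  have gf': "(\<Sum>p\<in>?I. \<Sum>s\<in>?I. D r p s \<cdot> (g (lreg G p) \<odot>\<^bsub>?I\<^esub> f (lreg G s))) =
      \<epsilon> (lreg G r) \<cdot> mone ?I" if "r \<in> ?I" for r
    using gf[OF l[OF that]] tensor_lift_coords[OF bilinear_on_mmult[OF g(1) f] T[OF l[OF that]]]
    by (simp add: D_def)
  have fh': "(\<Sum>s\<in>?I. \<Sum>t\<in>?I. D q s t \<cdot> (f (lreg G s) \<odot>\<^bsub>?I\<^esub> h (lreg G t))) =
      \<epsilon> (lreg G q) \<cdot> mone ?I" if "q \<in> ?I" for q
    using fh[OF l[OF that]] tensor_lift_coords[OF bilinear_on_mmult[OF f h(1)] T[OF l[OF that]]]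
    by (simp add: D_def)
  \<comment> \<open>\<open>g = g * (f * h)\<close>: write the counit in \<open>X = (id \<otimes> \<epsilon>) (\<Delta> X)\<close> as \<open>f * h\<close>.\<close>
  have "X = (\<Sum>p\<in>?I. \<Sum>q\<in>?I. c p q \<cdot> \<epsilon> (lreg G q) \<cdot> lreg G p)"
    using counit X tensor_lift_coords[OF \<epsilon>r T[OF X]] unfolding is_counit_def by (simp add: c_def)
  then have "g X = g (\<Sum>p\<in>?I. \<Sum>q\<in>?I. c p q \<cdot> \<epsilon> (lreg G q) \<cdot> lreg G p)"
    by simp
  also have "\<dots> = (\<Sum>p\<in>?I. \<Sum>q\<in>?I. g (c p q \<cdot> \<epsilon> (lreg G q) \<cdot> lreg G p))"
    by (simp add: linear_map_sum[OF A g(1)] star_subalgebra_msmult[OF A] star_subalgebra_sum[OF A] l)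
  also have "\<dots> = (\<Sum>p\<in>?I. \<Sum>q\<in>?I. c p q \<cdot> (g (lreg G p) \<odot>\<^bsub>?I\<^esub> (\<epsilon> (lreg G q) \<cdot> mone ?I)))"
    by (simp add: linear_map_msmult[OF g(1)] star_subalgebra_msmult[OF A] l mmult_msmult_right gm)
  also have "\<dots> = (\<Sum>p\<in>?I. \<Sum>q\<in>?I. c p q \<cdot> (g (lreg G p) \<odot>\<^bsub>?I\<^esub>
      (\<Sum>s\<in>?I. \<Sum>t\<in>?I. D q s t \<cdot> (f (lreg G s) \<odot>\<^bsub>?I\<^esub> h (lreg G t)))))"
    by (simp add: fh')
  also have "\<dots> = (\<Sum>p\<in>?I. \<Sum>q\<in>?I. \<Sum>s\<in>?I. \<Sum>t\<in>?I. (c p q * D q s t) \<cdot> W p s t)"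
    by (simp add: mmult_sum_right mmult_msmult_right msmult_sum msmult_msmult W_def)
  \<comment> \<open>Collect the coefficient of each \<open>W p s t\<close>, to which coassociativity applies.\<close>
  also have "\<dots> = (\<Sum>p\<in>?I. \<Sum>s\<in>?I. \<Sum>q\<in>?I. \<Sum>t\<in>?I. (c p q * D q s t) \<cdot> W p s t)"
    by (intro sum.cong refl sum.swap)
  also have "\<dots> = (\<Sum>p\<in>?I. \<Sum>s\<in>?I. \<Sum>t\<in>?I. \<Sum>q\<in>?I. (c p q * D q s t) \<cdot> W p s t)"
    by (intro sum.cong refl sum.swap)
  also have "\<dots> = (\<Sum>p\<in>?I. \<Sum>s\<in>?I. \<Sum>t\<in>?I. \<Sum>r\<in>?I. (c r t * D r p s) \<cdot> W p s t)"
  proof (rule sum.cong[OF refl], rule sum.cong[OF refl], rule sum.cong[OF refl])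
    fix p s t assume "p \<in> ?I" "s \<in> ?I" "t \<in> ?I"
    then show "(\<Sum>q\<in>?I. (c p q * D q s t) \<cdot> W p s t) = (\<Sum>r\<in>?I. (c r t * D r p s) \<cdot> W p s t)"
      using coassociative_coords[OF co lin ran X, of p s t]
      unfolding sum_msmult[symmetric] by (simp add: c_def D_def)
  qed
  \<comment> \<open>Move the sums over \<open>r\<close> and \<open>t\<close> outwards again, to recognise \<open>(g * f) * h\<close>.\<close>
  also have "\<dots> = (\<Sum>p\<in>?I. \<Sum>s\<in>?I. \<Sum>r\<in>?I. \<Sum>t\<in>?I. (c r t * D r p s) \<cdot> W p s t)"
    by (intro sum.cong refl sum.swap)
  also have "\<dots> = (\<Sum>p\<in>?I. \<Sum>r\<in>?I. \<Sum>s\<in>?I. \<Sum>t\<in>?I. (c r t * D r p s) \<cdot> W p s t)"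
    by (intro sum.cong refl sum.swap)
  also have "\<dots> = (\<Sum>r\<in>?I. \<Sum>p\<in>?I. \<Sum>s\<in>?I. \<Sum>t\<in>?I. (c r t * D r p s) \<cdot> W p s t)"
    by (rule sum.swap)
  also have "\<dots> = (\<Sum>r\<in>?I. \<Sum>p\<in>?I. \<Sum>t\<in>?I. \<Sum>s\<in>?I. (c r t * D r p s) \<cdot> W p s t)"
    by (intro sum.cong refl sum.swap)
  also have "\<dots> = (\<Sum>r\<in>?I. \<Sum>t\<in>?I. \<Sum>p\<in>?I. \<Sum>s\<in>?I. (c r t * D r p s) \<cdot> W p s t)"
    by (intro sum.cong refl sum.swap)
  also have "\<dots> = (\<Sum>r\<in>?I. \<Sum>t\<in>?I. c r t \<cdot>
      ((\<Sum>p\<in>?I. \<Sum>s\<in>?I. D r p s \<cdot> (g (lreg G p) \<odot>\<^bsub>?I\<^esub> f (lreg G s))) \<odot>\<^bsub>?I\<^esub> h (lreg G t)))"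
    by (simp add: mmult_sum_left mmult_msmult_left msmult_sum msmult_msmult W_def mmult_assoc)
  also have "\<dots> = (\<Sum>r\<in>?I. \<Sum>t\<in>?I. h (c r t \<cdot> \<epsilon> (lreg G r) \<cdot> lreg G t))"
    by (simp add: gf' mmult_msmult_left hm l linear_map_msmult[OF h(1)] star_subalgebra_msmult[OF A])
  also have "\<dots> = h (\<Sum>r\<in>?I. \<Sum>t\<in>?I. c r t \<cdot> \<epsilon> (lreg G r) \<cdot> lreg G t)"
    by (simp add: linear_map_sum[OF A h(1)] star_subalgebra_msmult[OF A] star_subalgebra_sum[OF A] l)
  also have "\<dots> = h X"
    using counit X tensor_lift_coords[OF \<epsilon>l T[OF X]] unfolding is_counit_def by (simp add: c_def)
  finally show ?thesis .
qed

text \<open>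
  Both \<open>f \<circ> \<kappa>\<close> and \<open>\<kappa> \<circ> f\<close> are convolution inverses of \<open>f\<close>. The first is a left inverse because \<open>f\<close>
  is multiplicative and can be pulled out of \<open>\<kappa>(a) b\<close>; the second is a right inverse because \<open>f\<close> is
  comultiplicative, so the antipode axiom can be applied at \<open>f(X)\<close>.
\<close>

lemma bialgebra_endomorphism_commutes_antipode:
  assumes kac: "kac_algebra (carrier G) (group_alg G) \<Delta> \<epsilon> \<kappa>"
    and f: "star_hom (carrier G) (group_alg G) (carrier G) (group_alg G) f"
    and comult: "\<And>X. X \<in> group_alg G \<Longrightarrow>
      tensor_map (group_alg G) (group_alg G) f f (\<Delta> X) = \<Delta> (f X)"
    and counit: "\<And>X. X \<in> group_alg G \<Longrightarrow> \<epsilon> (f X) = \<epsilon> X"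
    and X: "X \<in> group_alg G"
  shows "f (\<kappa> X) = \<kappa> (f X)"
proof -
  let ?A = "group_alg G" and ?I = "carrier G"
  note A = star_subalgebra_group_alg
  have co: "coassociative ?A \<Delta>" and \<Delta>: "linear_map ?A \<Delta>" "\<Delta> \<in> ?A \<rightarrow> tensor ?A ?A"
    and cu: "is_counit ?I ?A \<Delta> \<epsilon>" and \<kappa>: "linear_map ?A \<kappa>" "\<kappa> \<in> ?A \<rightarrow> ?A"
    using kac unfolding kac_algebra_def star_hom_def is_antipode_def by auto
  have \<kappa>l: "tensor_lift ?A ?A (\<lambda>a b. \<kappa> a \<odot>\<^bsub>?I\<^esub> b) (\<Delta> Y) = \<epsilon> Y \<cdot> mone ?I"
    and \<kappa>r: "tensor_lift ?A ?A (\<lambda>a b. a \<odot>\<^bsub>?I\<^esub> \<kappa> b) (\<Delta> Y) = \<epsilon> Y \<cdot> mone ?I"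
    if "Y \<in> ?A" for Y
    using kac that unfolding kac_algebra_def is_antipode_def by auto
  have fA: "f \<in> ?A \<rightarrow> ?A" and fl: "linear_map ?A f" and f1: "f (mone ?I) = mone ?I"
    and fm: "\<And>Y Z. Y \<in> ?A \<Longrightarrow> Z \<in> ?A \<Longrightarrow> f (Y \<odot>\<^bsub>?I\<^esub> Z) = f Y \<odot>\<^bsub>?I\<^esub> f Z"
    using f unfolding star_hom_def by auto
  have left: "tensor_lift ?A ?A (\<lambda>a b. f (\<kappa> a) \<odot>\<^bsub>?I\<^esub> f b) (\<Delta> Y) = \<epsilon> Y \<cdot> mone ?I"
    if Y: "Y \<in> ?A" for Y
  proof -
    obtain n :: nat and a b where ab: "\<forall>k<n. a k \<in> ?A \<and> b k \<in> ?A"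
      and T: "\<Delta> Y = (\<Sum>k<n. kron (a k) (b k))"
      using \<Delta>(2) Y unfolding tensor_def by blast
    have ab': "a k \<in> ?A" "b k \<in> ?A" "\<kappa> (a k) \<in> ?A" if "k \<in> {..<n}" for k
      using ab \<kappa>(2) that by auto
    have "tensor_lift ?A ?A (\<lambda>a b. f (\<kappa> a) \<odot>\<^bsub>?I\<^esub> f b) (\<Delta> Y) =
        (\<Sum>k<n. f (\<kappa> (a k) \<odot>\<^bsub>?I\<^esub> b k))"
      by (simp add: tensor_lift_eq[OF bilinear_on_mmult[OF linear_map_compose[OF \<kappa> fl] fl] ab T]
          fm ab')
    also have "\<dots> = f (\<Sum>k<n. \<kappa> (a k) \<odot>\<^bsub>?I\<^esub> b k)"
      by (rule linear_map_sum[OF A fl, symmetric]) (intro star_subalgebra_mmult[OF A] ab')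
    also have "(\<Sum>k<n. \<kappa> (a k) \<odot>\<^bsub>?I\<^esub> b k) = \<epsilon> Y \<cdot> mone ?I"
      using \<kappa>l[OF Y] tensor_lift_eq[OF bilinear_on_mmult[OF \<kappa>(1) linear_map_id] ab T] by simp
    also have "f (\<epsilon> Y \<cdot> mone ?I) = \<epsilon> Y \<cdot> mone ?I"
      by (simp add: linear_map_msmult[OF fl star_subalgebra_mone[OF A]] f1)
    finally show ?thesis .
  qed
  have right: "tensor_lift ?A ?A (\<lambda>a b. f a \<odot>\<^bsub>?I\<^esub> \<kappa> (f b)) (\<Delta> Y) = \<epsilon> Y \<cdot> mone ?I"
    if Y: "Y \<in> ?A" for Y
  proof -
    obtain n :: nat and a b where ab: "\<forall>k<n. a k \<in> ?A \<and> b k \<in> ?A"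
      and T: "\<Delta> Y = (\<Sum>k<n. kron (a k) (b k))"
      using \<Delta>(2) Y unfolding tensor_def by blast
    have fab: "\<forall>k<n. f (a k) \<in> ?A \<and> f (b k) \<in> ?A"
      using ab fA by auto
    have "\<Delta> (f Y) = (\<Sum>k<n. kron (f (a k)) (f (b k)))"
      using comult[OF Y] tensor_lift_eq[OF bilinear_on_kron[OF fl fl] ab T]
      by (simp add: tensor_map_def)
    then have "tensor_lift ?A ?A (\<lambda>a b. a \<odot>\<^bsub>?I\<^esub> \<kappa> b) (\<Delta> (f Y)) =
        (\<Sum>k<n. f (a k) \<odot>\<^bsub>?I\<^esub> \<kappa> (f (b k)))"
      by (rule tensor_lift_eq[OF bilinear_on_mmult[OF linear_map_id \<kappa>(1)] fab])
    also have "\<dots> = tensor_lift ?A ?A (\<lambda>a b. f a \<odot>\<^bsub>?I\<^esub> \<kappa> (f b)) (\<Delta> Y)"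
      by (simp add: tensor_lift_eq[OF bilinear_on_mmult[OF fl linear_map_compose[OF fl fA \<kappa>(1)]] ab T])
    finally show ?thesis
      using \<kappa>r[of "f Y"] fA Y counit[OF Y] by auto
  qed
  show ?thesis
    by (rule convolution_inverse_unique[OF co \<Delta> cu fl linear_map_compose[OF \<kappa> fl] _
          linear_map_compose[OF fl fA \<kappa>(1)] _ left right X]) (use fA \<kappa>(2) in auto)
qed


end


section \<open>Group automorphisms as relabellings of matrix entries\<close>

definition relabel :: "('i \<Rightarrow> 'i) \<Rightarrow> 'i mtx \<Rightarrow> 'i mtx" where
  "relabel \<rho> X = (\<lambda>i j. X (\<rho> i) (\<rho> j))"

lemma relabel_sum: "relabel \<rho> (\<Sum>k\<in>K. f k) = (\<Sum>k\<in>K. relabel \<rho> (f k))"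
  by (simp add: fun_eq_iff relabel_def sum_mtx_apply)

lemma relabel_msmult: "relabel \<rho> (c \<cdot> X) = c \<cdot> relabel \<rho> X"
  by (simp add: fun_eq_iff relabel_def msmult_def)

lemma relabel_madj: "relabel \<rho> (madj X) = madj (relabel \<rho> X)"
  by (simp add: fun_eq_iff relabel_def madj_def)

lemma relabel_kron: "relabel (map_prod \<rho> \<sigma>) (kron X Y) = kron (relabel \<rho> X) (relabel \<sigma> Y)"
  by (simp add: fun_eq_iff relabel_def kron_def)

lemma relabel_mmult:
  assumes "bij_betw \<rho> I I"
  shows "relabel \<rho> (X \<odot>\<^bsub>I\<^esub> Y) = relabel \<rho> X \<odot>\<^bsub>I\<^esub> relabel \<rho> Y"
proof (intro ext)
  fix i j
  show "relabel \<rho> (X \<odot>\<^bsub>I\<^esub> Y) i j = (relabel \<rho> X \<odot>\<^bsub>I\<^esub> relabel \<rho> Y) i j"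
    unfolding relabel_def mmult_def by (rule sum.reindex_bij_betw[OF assms, symmetric])
qed

context finite_group
begin

text \<open>
  The inverse of \<open>\<alpha>\<close> on the carrier, continued by the identity: points outside the carrier then stay
  outside, so that relabelling by it preserves matrices supported on the carrier.
\<close>

definition aut_inv :: "('a \<Rightarrow> 'a) \<Rightarrow> 'a \<Rightarrow> 'a" where
  "aut_inv \<alpha> i = (if i \<in> carrier G then inv_into (carrier G) \<alpha> i else i)"

lemma linear_map_extend_aut: "linear_map S (extend_aut G \<alpha>)"
  by (simp add: linear_map_def extend_aut_def fun_eq_iff sum_mtx_apply msmult_def
      sum.distrib sum_distrib_left algebra_simps)

lemma extend_aut_lreg: "g \<in> carrier G \<Longrightarrow> extend_aut G \<alpha> (lreg G g) = lreg G (\<alpha> g)"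
  by (rule lreg_extension_values(4)[OF is_group finite_carrier])

lemma extend_aut_compose:
  assumes "\<And>g. g \<in> carrier G \<Longrightarrow> \<beta> g \<in> carrier G"
  shows "extend_aut G \<alpha> (extend_aut G \<beta> X) = extend_aut G (\<lambda>g. \<alpha> (\<beta> g)) X"
proof -
  note A = star_subalgebra_group_alg
  have l: "lreg G (\<beta> g) \<in> group_alg G" if "g \<in> carrier G" for g
    using assms[OF that] by (rule lreg_in_group_alg)
  have "extend_aut G \<alpha> (extend_aut G \<beta> X) =
      (\<Sum>g\<in>carrier G. extend_aut G \<alpha> (X g \<one> \<cdot> lreg G (\<beta> g)))"
    unfolding extend_aut_def[of G \<beta>]
    by (rule linear_map_sum[OF A linear_map_extend_aut]) (intro star_subalgebra_msmult[OF A] l)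
  also have "\<dots> = (\<Sum>g\<in>carrier G. X g \<one> \<cdot> lreg G (\<alpha> (\<beta> g)))"
    by (intro sum.cong refl)
      (simp add: linear_map_msmult[OF linear_map_extend_aut l] extend_aut_lreg assms)
  finally show ?thesis by (simp add: extend_aut_def)
qed

lemma extend_aut_id:
  assumes "\<And>g. g \<in> carrier G \<Longrightarrow> \<alpha> g = g" "X \<in> group_alg G"
  shows "extend_aut G \<alpha> X = X"
  using expansion[OF assms(2)] by (simp add: extend_aut_def assms(1))

lemma extend_aut_closed:
  assumes "\<And>g. g \<in> carrier G \<Longrightarrow> \<alpha> g \<in> carrier G"
  shows "extend_aut G \<alpha> X \<in> group_alg G"
  unfolding extend_aut_def
  by (intro star_subalgebra_sum[OF star_subalgebra_group_alg] lreg_in_group_alg assms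
      star_subalgebra_msmult[OF star_subalgebra_group_alg])

end

locale finite_group_automorphism = finite_group +
  fixes \<alpha> :: "'a \<Rightarrow> 'a"
  assumes iso: "\<alpha> \<in> iso G G"
begin

abbreviation "\<rho> \<equiv> aut_inv \<alpha>"
abbreviation "\<alpha>' \<equiv> extend_aut G \<alpha>"

lemma aut_bij: "bij_betw \<alpha> (carrier G) (carrier G)"
  and aut_mult: "g \<in> carrier G \<Longrightarrow> h \<in> carrier G \<Longrightarrow> \<alpha> (g \<otimes> h) = \<alpha> g \<otimes> \<alpha> h"
  and aut_closed: "g \<in> carrier G \<Longrightarrow> \<alpha> g \<in> carrier G"
  using iso by (auto simp: iso_def hom_def)

lemma aut_inv_bij: "bij_betw \<rho> (carrier G) (carrier G)"
  using bij_betw_inv_into[OF aut_bij] by (subst bij_betw_cong[where g = "inv_into (carrier G) \<alpha>"])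
    (auto simp: aut_inv_def)

lemma aut_inv_closed: "g \<in> carrier G \<Longrightarrow> \<rho> g \<in> carrier G"
  using aut_inv_bij by (auto simp: bij_betw_def)

lemma aut_aut_inv: "g \<in> carrier G \<Longrightarrow> \<alpha> (\<rho> g) = g"
  using bij_betw_inv_into_right[OF aut_bij] by (simp add: aut_inv_def)

lemma aut_inv_aut: "g \<in> carrier G \<Longrightarrow> \<rho> (\<alpha> g) = g"
  using bij_betw_inv_into_left[OF aut_bij] by (simp add: aut_inv_def aut_closed)

lemma aut_inv_notin: "g \<notin> carrier G \<Longrightarrow> \<rho> g = g"
  by (simp add: aut_inv_def)

text \<open>
  Applying \<open>\<alpha>\<close>, the inverse of \<open>\<rho>\<close>, turns the relation \<open>\<rho>(i) = g \<rho>(j)\<close> into \<open>i = \<alpha>(g) j\<close>.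
\<close>

lemma relabel_lreg:
  assumes g: "g \<in> carrier G"
  shows "relabel \<rho> (lreg G g) = lreg G (\<alpha> g)"
proof (intro ext)
  fix i j
  \<comment> \<open>For \<open>i\<close> outside the carrier both sides fail, because \<open>\<rho>\<close> keeps \<open>i\<close> outside.\<close>
  have "\<rho> i = g \<otimes> \<rho> j \<longleftrightarrow> i = \<alpha> g \<otimes> j" if j: "j \<in> carrier G"
  proof (cases "i \<in> carrier G")
    case True
    have "\<rho> i = g \<otimes> \<rho> j \<longleftrightarrow> \<alpha> (\<rho> i) = \<alpha> (g \<otimes> \<rho> j)"
      using aut_inv_aut True g aut_inv_closed[OF True] aut_inv_closed[OF j] by (metis m_closed)
    then show ?thesis
      by (simp add: True j g aut_aut_inv aut_mult aut_inv_closed)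
  next
    case False
    then show ?thesis
      using g j aut_closed aut_inv_closed aut_inv_notin by (metis m_closed)
  qed
  moreover have "\<rho> j \<in> carrier G \<longleftrightarrow> j \<in> carrier G"
    using aut_inv_closed aut_inv_notin by metis
  ultimately show "relabel \<rho> (lreg G g) i j = lreg G (\<alpha> g) i j"
    unfolding relabel_def lreg_def by auto
qed

lemma extend_aut_eq_relabel:
  assumes "X \<in> group_alg G"
  shows "\<alpha>' X = relabel \<rho> X"
proof -
  have "relabel \<rho> X = relabel \<rho> (\<Sum>g\<in>carrier G. X g \<one> \<cdot> lreg G g)"
    using expansion[OF assms] by simp
  also have "\<dots> = \<alpha>' X"
    unfolding relabel_sum relabel_msmult extend_aut_def by (simp add: relabel_lreg)
  finally show ?thesis by simp
qed

lemma tensor_map_extend_aut: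
  assumes "T \<in> tensor (group_alg G) (group_alg G)"
  shows "tensor_map (group_alg G) (group_alg G) \<alpha>' \<alpha>' T = relabel (map_prod \<rho> \<rho>) T"
proof -
  obtain n :: nat and a b where ab: "\<forall>k<n. a k \<in> group_alg G \<and> b k \<in> group_alg G"
    and T: "T = (\<Sum>k<n. kron (a k) (b k))"
    using assms unfolding tensor_def by blast
  have "tensor_map (group_alg G) (group_alg G) \<alpha>' \<alpha>' T = (\<Sum>k<n. kron (\<alpha>' (a k)) (\<alpha>' (b k)))"
    unfolding tensor_map_def
    by (rule tensor_lift_eq[OF bilinear_on_kron[OF linear_map_extend_aut linear_map_extend_aut] ab T])
  also have "\<dots> = relabel (map_prod \<rho> \<rho>) T"
    using ab by (simp add: T relabel_sum relabel_kron extend_aut_eq_relabel)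
  finally show ?thesis .
qed

lemma star_hom_extend_aut: "star_hom (carrier G) (group_alg G) (carrier G) (group_alg G) \<alpha>'"
proof -
  note A = star_subalgebra_group_alg
  have "\<alpha> \<one> = \<one>"
    using iso hom_one[of \<alpha> G G] is_group by (simp add: iso_def)
  then have "\<alpha>' (mone (carrier G)) = mone (carrier G)"
    using extend_aut_lreg[of \<one> \<alpha>] by (simp add: lreg_one[OF is_group])
  moreover have "\<alpha>' \<in> group_alg G \<rightarrow> group_alg G"
    by (simp add: extend_aut_closed aut_closed)
  ultimately show ?thesis
    unfolding star_hom_def
    by (simp add: linear_map_extend_aut extend_aut_eq_relabel
        star_subalgebra_mmult[OF A] star_subalgebra_madj[OF A] relabel_mmult[OF aut_inv_bij]
        relabel_madj)
qed

lemma bij_betw_extend_aut: "bij_betw \<alpha>' (group_alg G) (group_alg G)"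
proof (rule bij_betw_byWitness[where f' = "extend_aut G \<rho>"])
  show "\<forall>X\<in>group_alg G. extend_aut G \<rho> (\<alpha>' X) = X"
    by (simp add: extend_aut_compose aut_closed aut_inv_aut extend_aut_id)
  show "\<forall>X\<in>group_alg G. \<alpha>' (extend_aut G \<rho> X) = X"
    by (simp add: extend_aut_compose aut_inv_closed aut_aut_inv extend_aut_id)
qed (auto simp: extend_aut_closed aut_closed aut_inv_closed)

lemma extend_aut_coeff:
  assumes g: "g \<in> carrier G"
  shows "\<alpha>' X (\<alpha> g) \<one> = X g \<one>"
proof -
  have "\<alpha>' X (\<alpha> g) \<one> = (\<Sum>h\<in>carrier G. if h = g then X h \<one> else 0)"
    unfolding extend_aut_def sum_mtx_apply msmult_def
    using g aut_inv_aut by (intro sum.cong refl) (auto simp: lreg_coeff_one aut_closed, metis)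
  then show ?thesis using g finite_carrier by simp
qed

lemma counit_extend_aut: "counit G (\<alpha>' X) = counit G X"
  unfolding counit_def sum.reindex_bij_betw[OF aut_bij, of "\<lambda>g. \<alpha>' X g \<one>", symmetric]
  by (simp add: extend_aut_coeff)

lemma coprod_extend_aut: "relabel (map_prod \<rho> \<rho>) (coprod G X) = coprod G (\<alpha>' X)"
  unfolding coprod_def sum.reindex_bij_betw[OF aut_bij, of "\<lambda>g. \<alpha>' X g \<one> \<cdot> kron (lreg G g) (lreg G g)", symmetric]
  by (simp add: extend_aut_coeff relabel_sum relabel_msmult relabel_kron relabel_lreg)

lemma coprod_closed: "coprod G X \<in> tensor (group_alg G) (group_alg G)"
  unfolding coprod_def
  by (intro tensor_sum tensor_msmult[OF star_subalgebra_group_alg] tensor_kron lreg_in_group_alg)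

text \<open>
  The hypothesis on \<open>Ad \<Omega>\<close> is applied to the elements \<open>\<Delta>(X)\<close> and yields compatibility with the twisted
  coproduct. Uniqueness of antipodes then gives compatibility with \<open>\<kappa>\<close>, whose formula is left open.
\<close>

lemma extend_aut_kac_automorphism:
  assumes kac: "kac_algebra (carrier G) (group_alg G) (twisted_coprod G \<Omega>) (counit G) \<kappa>"
    and Ad: "\<forall>X\<in>tensor (group_alg G) (group_alg G).
             tensor_map (group_alg G) (group_alg G) \<alpha>' \<alpha>' (Ad G \<Omega> X) =
             Ad G \<Omega> (tensor_map (group_alg G) (group_alg G) \<alpha>' \<alpha>' X)"
  shows "kac_automorphism (carrier G) (group_alg G) (twisted_coprod G \<Omega>) (counit G) \<kappa> \<alpha>'"
proof -
  have comult: "tensor_map (group_alg G) (group_alg G) \<alpha>' \<alpha>' (twisted_coprod G \<Omega> X) =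
      twisted_coprod G \<Omega> (\<alpha>' X)" for X
    using Ad by (simp add: twisted_coprod_def coprod_closed tensor_map_extend_aut coprod_extend_aut)
  then have "\<alpha>' (\<kappa> X) = \<kappa> (\<alpha>' X)" if "X \<in> group_alg G" for X
    using that by (intro bialgebra_endomorphism_commutes_antipode[OF kac star_hom_extend_aut] counit_extend_aut)
  then show ?thesis
    unfolding kac_automorphism_def
    by (simp add: star_hom_extend_aut bij_betw_extend_aut comult counit_extend_aut)
qed


section \<open>Automorphisms that fix the subgroup\<close>

text \<open>
  The fixed points of a *-homomorphism form a *-subalgebra, so it is enough to look at generators.
\<close>

lemma extend_aut_fixes_group_cstar:
  assumes H: "H \<subseteq> carrier G" and fix_H: "\<And>h. h \<in> H \<Longrightarrow> \<alpha> h = h" and X: "X \<in> group_cstar G H"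
  shows "\<alpha>' X = X"
proof -
  let ?F = "{X \<in> group_alg G. \<alpha>' X = X}"
  note A = star_subalgebra_group_alg
  have "star_subalgebra (carrier G) ?F"
    using star_hom_extend_aut star_subalgebraD[OF A]
    unfolding star_hom_def star_subalgebra_def linear_map_def by auto
  moreover have "lreg G ` H \<subseteq> ?F"
    using H by (auto simp: extend_aut_lreg fix_H lreg_in_group_alg)
  ultimately have "group_cstar G H \<subseteq> ?F"
    unfolding group_cstar_def cstar_generated_def by (intro hull_minimal)
  then show ?thesis using X by auto
qed

lemma group_cstar_mono: "H \<subseteq> carrier G \<Longrightarrow> group_cstar G H \<subseteq> group_alg G"
  unfolding group_cstar_def cstar_generated_def by (intro hull_mono image_mono)

text \<open>
  The legs of \<open>\<Omega>\<close> lie in the algebra generated by \<open>\<lambda>(H)\<close>, which \<open>\<alpha>\<close> fixes pointwise; so \<open>\<alpha> \<otimes> \<alpha>\<close>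
  fixes \<open>\<Omega>\<close>, and as a relabelling it is multiplicative and *-preserving.
\<close>

lemma extend_aut_commutes_Ad:
  assumes H: "H \<subseteq> carrier G" and fix_H: "\<And>h. h \<in> H \<Longrightarrow> \<alpha> h = h"
    and \<Omega>: "\<Omega> \<in> tensor (group_cstar G H) (group_cstar G H)"
    and X: "X \<in> tensor (group_alg G) (group_alg G)"
  shows "tensor_map (group_alg G) (group_alg G) \<alpha>' \<alpha>' (Ad G \<Omega> X) =
         Ad G \<Omega> (tensor_map (group_alg G) (group_alg G) \<alpha>' \<alpha>' X)"
proof -
  note A = star_subalgebra_group_alg
  have \<Omega>A: "\<Omega> \<in> tensor (group_alg G) (group_alg G)"
    using \<Omega> tensor_mono[OF group_cstar_mono[OF H] group_cstar_mono[OF H]] by blast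
  have AdA: "Ad G \<Omega> X \<in> tensor (group_alg G) (group_alg G)"
    unfolding Ad_def by (intro tensor_mmult[OF A A] tensor_madj[OF A A] \<Omega>A X)
  obtain n :: nat and a b where ab: "\<forall>k<n. a k \<in> group_cstar G H \<and> b k \<in> group_cstar G H"
    and T: "\<Omega> = (\<Sum>k<n. kron (a k) (b k))"
    using \<Omega> unfolding tensor_def by blast
  have "relabel \<rho> Y = Y" if "Y \<in> group_cstar G H" for Y
    using extend_aut_fixes_group_cstar[OF H fix_H that] group_cstar_mono[OF H] that
    by (auto simp: extend_aut_eq_relabel)
  then have inv: "relabel (map_prod \<rho> \<rho>) \<Omega> = \<Omega>"
    using ab by (simp add: T relabel_sum relabel_kron)
  have bij: "bij_betw (map_prod \<rho> \<rho>) (carrier2 G) (carrier2 G)"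
    by (rule bij_betw_map_prod[OF aut_inv_bij aut_inv_bij])
  have "relabel (map_prod \<rho> \<rho>) (Ad G \<Omega> X) = Ad G \<Omega> (relabel (map_prod \<rho> \<rho>) X)"
    by (simp add: Ad_def relabel_mmult[OF bij] relabel_madj inv)
  then show ?thesis by (simp add: tensor_map_extend_aut X AdA)
qed

end

theorem proposition3p5:
  fixes G :: "('g, 'm) monoid_scheme" and H :: "'g set"
    and \<Omega> :: "('g \<times> 'g) mtx" and u :: "'g mtx" and \<alpha> :: "'g \<Rightarrow> 'g"
  assumes "group G" and "finite (carrier G)"
    and "subgroup H G" and "comm_group (G\<lparr>carrier := H\<rparr>)"
    and "\<Omega> \<in> tensor (group_cstar G H) (group_cstar G H)"
    and "lifted_from G H \<Omega>"
    and "u = lift_unitary G \<Omega>"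
    and "two_cocycle G \<Omega> \<or> two_pseudo_cocycle G \<Omega>"
    and "co_involutive G \<Omega> u \<or> pseudo_co_involutive G \<Omega> u"
    and "kac_algebra (carrier G) (group_alg G)
           (twisted_coprod G \<Omega>) (counit G) (twisted_antipode G u)"
    and "\<alpha> \<in> iso G G"
  shows "((\<forall>X\<in>tensor (group_alg G) (group_alg G).
             tensor_map (group_alg G) (group_alg G) (extend_aut G \<alpha>) (extend_aut G \<alpha>) (Ad G \<Omega> X) =
             Ad G \<Omega> (tensor_map (group_alg G) (group_alg G) (extend_aut G \<alpha>) (extend_aut G \<alpha>) X)) \<longrightarrow>
          kac_automorphism (carrier G) (group_alg G)
            (twisted_coprod G \<Omega>) (counit G) (twisted_antipode G u) (extend_aut G \<alpha>)) \<and>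
         ((\<forall>h\<in>H. \<alpha> h = h) \<longrightarrow>
          (\<forall>X\<in>tensor (group_alg G) (group_alg G).
             tensor_map (group_alg G) (group_alg G) (extend_aut G \<alpha>) (extend_aut G \<alpha>) (Ad G \<Omega> X) =
             Ad G \<Omega> (tensor_map (group_alg G) (group_alg G) (extend_aut G \<alpha>) (extend_aut G \<alpha>) X)) \<and>
          kac_automorphism (carrier G) (group_alg G)
            (twisted_coprod G \<Omega>) (counit G) (twisted_antipode G u) (extend_aut G \<alpha>))"
proof -
  interpret finite_group_automorphism G \<alpha>
    using assms(1,2,11)
    by (simp add: finite_group_automorphism_def finite_group_automorphism_axioms_def
        finite_group_def finite_group_axioms_def)
  have H: "H \<subseteq> carrier G" using assms(3) by (rule subgroup.subset)
  show ?thesis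
    using extend_aut_kac_automorphism[OF assms(10)] extend_aut_commutes_Ad[OF H _ assms(5)] by blast
qed

end
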